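(* Assume the vertically homogeneous case, in which $\lambda(x_1,x_2)=\lambda(x_1)$ and $\mu(x_1,x_2)=\mu(x_1)$ do not depend on $x_2$, for all $(x_1,x_2)\in\mathbb R^2$. Then there exists $C<\infty$ such that, for any $\alpha>2$ and all $\ell\ge1$, $$\sup\big\{\mathbb P\big(\tau_{\ell^{1/\alpha}}(\boldsymbol x)\ge\ell\big):\boldsymbol x\in\mathbb S\big\}<C\,\ell^{1/\alpha-1/2}.$$
   Context: $\mathbb S=\mathbb Z\times\mathbb R$. Let $\lambda:\mathbb R^2\to(0,\infty)$ be continuous, $\Xi$-Lipschitz in its second argument for some $\Xi>0$, with $0<\lambda_{\min}\le\lambda\le\lambda_{\max}<\infty$, and let $\mu:\mathbb R^2\to[0,\infty)$ be continuous, bounded and $\Xi$-Lipschitz in its second argument (the traffic generated per node is $\mu(\cdot/\ell^2)$; it plays no role for $\tau_\ell$). For $\ell>0$ put $\lambda_\ell(\boldsymbol x)=\lambda(\boldsymbol x/\ell^2)$. For $x_1\in\mathbb Z$ let $\mathcal P_{\ell,x_1}$ be independent Poisson point processes on $\mathbb R$ with intensity $\lambda_\ell(x_1,x_2)\,\mathrm dx_2$, and let $\mathcal P_\ell=\bigcup_{x_1\in\mathbb Z}\{x_1\}\times\mathcal P_{\ell,x_1}$ be the set of nodes. Each node $(x_1,x_2)\in\mathcal P_\ell$ has exactly one outgoing directed edge, to the (a.s. unique) node $(x_1-1,y)\in\mathcal P_\ell$ minimizing $|x_2-y|$. Let $I_\ell(\boldsymbol x)=\{x_1\}\times[x_2-\ell/2,x_2+\ell/2]$.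 $\tau_\ell(\boldsymbol x)$ (based on $\mathcal P_\ell$) is the maximum, over all nodes $\boldsymbol y\in\mathcal P_\ell$ whose directed path (including $\boldsymbol y$) visits a node in $I_\ell(\boldsymbol x)$, of the number of nodes on the directed path from $\boldsymbol y$ to its node in $I_\ell(\boldsymbol x)$, both included ($0$ if there is no such $\boldsymbol y$). Thus $\tau_{\ell^{1/\alpha}}$ is this quantity with $\ell$ replaced by $\ell^{1/\alpha}$ in both the environment and the slit. *)

theory Defs
  imports "HOL-Probability.Probability"
begin

definition locally_finite :: "real set \<Rightarrow> bool" where
  "locally_finite S \<longleftrightarrow> (\<forall>B. bounded B \<longrightarrow> finite (S \<inter> B))"

text \<open>The space of locally finite subsets of the line, with the sigma-algebra generated by the
  counting maps of bounded Borel sets. A point process is a random element of this space; in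
  particular its realisations are locally finite surely, not only almost surely, so that
  \<^term>\<open>card\<close> really counts points.\<close>

definition configurations :: "real set measure" where
  "configurations = sigma {S. locally_finite S}
     {{S. locally_finite S \<and> card (S \<inter> B) = n} | B n. B \<in> sets borel \<and> bounded B}"

text \<open>The law of the counts is spelled out through its mass function (with \<^term>\<open>0 ^ 0 = 1\<close>)
  because the library's Poisson distribution requires a strictly positive rate, while the mean may
  be \<^term>\<open>0\<close> here.\<close>

definition poisson_process :: "'w measure \<Rightarrow> ('w \<Rightarrow> real set) \<Rightarrow> (real \<Rightarrow> real) \<Rightarrow> bool" where
  "poisson_process M X f \<longleftrightarrow>
     X \<in> measurable M configurations \<and>
     (\<forall>B\<in>sets borel. bounded B \<longrightarrow>
        (\<forall>n. measure M {\<omega> \<in> space M. card (X \<omega> \<inter> B) = n}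
             = (LINT t:B|lborel. f t) ^ n / fact n * exp (- (LINT t:B|lborel. f t)))) \<and>
     (\<forall>B :: nat \<Rightarrow> real set.
        (\<forall>i. B i \<in> sets borel \<and> bounded (B i)) \<longrightarrow> disjoint_family B \<longrightarrow>
        prob_space.indep_vars M (\<lambda>_. count_space UNIV) (\<lambda>i \<omega>. card (X \<omega> \<inter> B i)) UNIV)"

definition rescale :: "(real \<times> real \<Rightarrow> real) \<Rightarrow> real \<Rightarrow> real \<times> real \<Rightarrow> real" where
  "rescale lam l = (\<lambda>(x1, x2). lam (x1 / l\<^sup>2, x2 / l\<^sup>2))"

text \<open>\<open>P x1\<close> is the point process on column \<open>x1\<close>; all columns are independent.\<close>

definition node_process ::
    "'w measure \<Rightarrow> (real \<times> real \<Rightarrow> real) \<Rightarrow> real \<Rightarrow> (int \<Rightarrow> 'w \<Rightarrow> real set) \<Rightarrow> bool" where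
  "node_process M lam l P \<longleftrightarrow>
     prob_space M \<and>
     (\<forall>x1. poisson_process M (P x1) (\<lambda>x2. rescale lam l (real_of_int x1, x2))) \<and>
     prob_space.indep_vars M (\<lambda>_. configurations) P UNIV"

definition nodes :: "(int \<Rightarrow> real set) \<Rightarrow> (int \<times> real) set" where
  "nodes c = {(x1, x2). x2 \<in> c x1}"

text \<open>Every node has an edge to a nearest node of the next column. The nearest node is almost
  surely unique; in case of a tie (a null event) there are edges to both candidates.\<close>

definition edges :: "(int \<Rightarrow> real set) \<Rightarrow> ((int \<times> real) \<times> (int \<times> real)) set" where
  "edges c = {((x1, x2), (y1, y2)).
     (x1, x2) \<in> nodes c \<and> (y1, y2) \<in> nodes c \<and> y1 = x1 - 1 \<and>
     (\<forall>z. (x1 - 1, z) \<in> nodes c \<longrightarrow> \<bar>x2 - y2\<bar> \<le> \<bar>x2 - z\<bar>)}"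

definition slit :: "real \<Rightarrow> int \<times> real \<Rightarrow> (int \<times> real) set" where
  "slit l x = {fst x} \<times> {snd x - l / 2 .. snd x + l / 2}"

text \<open>A directed path with \<open>k\<close> edges has \<open>k + 1\<close> nodes. A path moves one column to the left in
  each step, so it visits the slit at most once. The supremum over the empty set is \<open>0\<close>, and the
  value is infinite where the maximum does not exist.\<close>

definition tau :: "(int \<Rightarrow> real set) \<Rightarrow> real \<Rightarrow> int \<times> real \<Rightarrow> enat" where
  "tau c l x = Sup {enat (k + 1) | k y z.
     y \<in> nodes c \<and> z \<in> nodes c \<inter> slit l x \<and> (y, z) \<in> edges c ^^ k}"

text \<open>The remainder shows that events of the form \<^term>\<open>r \<le> tau c l x\<close> are measurable, so
  that their \<^term>\<open>measure\<close> is a genuine probability. The points of a locally finite set are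
  enumerated as the unique points in closed rational intervals.\<close>

lemma space_configurations: "space configurations = {S. locally_finite S}"
  unfolding configurations_def by (subst space_measure_of) auto

lemma count_sets:
  assumes "B \<in> sets borel" "bounded B"
  shows "{S \<in> space configurations. card (S \<inter> B) = n} \<in> sets configurations"
proof -
  have "{S. locally_finite S \<and> card (S \<inter> B) = n} \<in> sets configurations"
    unfolding configurations_def using assms by (subst sets_measure_of) auto
  then show ?thesis by (simp add: space_configurations)
qed

lemma count_measurable:
  assumes "X \<in> measurable M configurations" "B \<in> sets borel" "bounded B"
  shows "{\<omega> \<in> space M. card (X \<omega> \<inter> B) = n} \<in> sets M"
proof -
  have "X -` {S \<in> space configurations. card (S \<inter> B) = n} \<inter> space M \<in> sets M"
    using assms(1) count_sets[OF assms(2,3)] by (rule measurable_sets)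
  also have "X -` {S \<in> space configurations. card (S \<inter> B) = n} \<inter> space M
      = {\<omega> \<in> space M. card (X \<omega> \<inter> B) = n}"
    using measurable_space[OF assms(1)] by auto
  finally show ?thesis .
qed

definition isolates :: "rat \<times> rat \<Rightarrow> real set \<Rightarrow> bool" where
  "isolates q S \<longleftrightarrow> card (S \<inter> {of_rat (fst q)..of_rat (snd q)}) = 1"

definition point :: "rat \<times> rat \<Rightarrow> real set \<Rightarrow> real" where
  "point q S = (if isolates q S then the_elem (S \<inter> {of_rat (fst q)..of_rat (snd q)}) else 0)"

lemma point_isolates:
  assumes "isolates q S"
  shows "S \<inter> {of_rat (fst q)..of_rat (snd q)} = {point q S}"
proof -
  obtain y where y: "S \<inter> {of_rat (fst q)..of_rat (snd q)} = {y}"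
    using assms unfolding isolates_def by (auto simp: card_1_singleton_iff)
  with assms show ?thesis by (simp add: point_def)
qed

lemma locally_finite_eq_points:
  assumes "locally_finite S"
  shows "y \<in> S \<longleftrightarrow> (\<exists>q. isolates q S \<and> y = point q S)"
proof
  assume y: "y \<in> S"
  have fin: "finite (S \<inter> {y - 1..y + 1})"
    using assms by (auto simp: locally_finite_def)
  obtain e where e: "e > 0" "\<forall>z\<in>S \<inter> {y - 1..y + 1}. z \<noteq> y \<longrightarrow> e \<le> dist y z"
    using finite_set_avoid[OF fin, of y] by auto
  define d where "d = min e 1"
  have d: "0 < d" "d \<le> 1" "d \<le> e" using e(1) by (auto simp: d_def)
  obtain a where a: "y - d < of_rat a" "of_rat a < y"
    using of_rat_dense[of "y - d" y] d by auto
  obtain b where b: "y < of_rat b" "of_rat b < y + d"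
    using of_rat_dense[of y "y + d"] d by auto
  have "S \<inter> {of_rat a..of_rat b} = {y}"
  proof (intro equalityI subsetI)
    fix z assume z: "z \<in> S \<inter> {of_rat a..of_rat b}"
    then have "dist y z < d" using a b by (auto simp: dist_real_def)
    moreover have "z \<in> S \<inter> {y - 1..y + 1}" using z a b d by auto
    ultimately show "z \<in> {y}" using e(2) d by force
  qed (use y a b in auto)
  then have "isolates (a, b) S \<and> y = point (a, b) S"
    by (simp add: isolates_def point_def)
  then show "\<exists>q. isolates q S \<and> y = point q S" ..
next
  assume "\<exists>q. isolates q S \<and> y = point q S"
  then show "y \<in> S" using point_isolates by blast
qed

lemma isolates_measurable:
  assumes "X \<in> measurable M configurations"
  shows "Measurable.pred M (\<lambda>\<omega>. isolates q (X \<omega>))"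
  unfolding isolates_def pred_def by (intro count_measurable assms) auto

lemma point_measurable:
  assumes "X \<in> measurable M configurations"
  shows "(\<lambda>\<omega>. point q (X \<omega>)) \<in> borel_measurable M"
proof (rule borel_measurableI_le)
  fix t :: real
  let ?J = "{of_rat (fst q)..of_rat (snd q)} :: real set"
  have eq: "point q (X \<omega>) \<le> t \<longleftrightarrow>
      (isolates q (X \<omega>) \<and> card (X \<omega> \<inter> (?J \<inter> {..t})) = 1 \<or> \<not> isolates q (X \<omega>) \<and> 0 \<le> t)" for \<omega>
  proof (cases "isolates q (X \<omega>)")
    case True
    have "X \<omega> \<inter> (?J \<inter> {..t}) = {point q (X \<omega>)} \<inter> {..t}"
      using point_isolates[OF True] by blast
    then have "card (X \<omega> \<inter> (?J \<inter> {..t})) = (if point q (X \<omega>) \<le> t then 1 else 0)"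
      by simp
    then show ?thesis using True by simp
  qed (simp add: point_def)
  have "bounded (?J \<inter> {..t})"
    by (rule bounded_subset[of ?J]) auto
  then have [measurable]: "Measurable.pred M (\<lambda>\<omega>. card (X \<omega> \<inter> (?J \<inter> {..t})) = 1)"
    unfolding pred_def by (intro count_measurable assms) auto
  note [measurable] = isolates_measurable[OF assms]
  show "{\<omega> \<in> space M. point q (X \<omega>) \<le> t} \<in> sets M"
    unfolding eq by measurable
qed

lemma reach_measurable:
  assumes P: "\<And>i. P i \<in> measurable M configurations"
  shows "Measurable.pred M (\<lambda>\<omega>. isolates q (P (x1 + int k) \<omega>) \<and>
    (\<exists>z. ((x1 + int k, point q (P (x1 + int k) \<omega>)), z) \<in> edges (\<lambda>i. P i \<omega>) ^^ k \<and>
         z \<in> nodes (\<lambda>i. P i \<omega>) \<inter> slit l (x1, x2)))"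
proof (induction k arbitrary: q)
  case 0
  note [measurable] = isolates_measurable[OF P] point_measurable[OF P]
  have "isolates q (P x1 \<omega>) \<Longrightarrow> point q (P x1 \<omega>) \<in> P x1 \<omega>" for \<omega>
    using point_isolates by blast
  then have "(isolates q (P (x1 + int 0) \<omega>) \<and>
      (\<exists>z. ((x1 + int 0, point q (P (x1 + int 0) \<omega>)), z) \<in> edges (\<lambda>i. P i \<omega>) ^^ 0 \<and>
           z \<in> nodes (\<lambda>i. P i \<omega>) \<inter> slit l (x1, x2))) \<longleftrightarrow>
      isolates q (P x1 \<omega>) \<and> x2 - l / 2 \<le> point q (P x1 \<omega>) \<and> point q (P x1 \<omega>) \<le> x2 + l / 2" for \<omega>
    by (auto simp: nodes_def slit_def)
  then show ?case by simp
next
  case (Suc k)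
  let ?c = "\<lambda>\<omega> i. P i \<omega>"
  let ?i = "x1 + int (Suc k)" and ?j = "x1 + int k"
  let ?R = "\<lambda>k q \<omega>. isolates q (P (x1 + int k) \<omega>) \<and>
    (\<exists>z. ((x1 + int k, point q (P (x1 + int k) \<omega>)), z) \<in> edges (?c \<omega>) ^^ k \<and>
         z \<in> nodes (?c \<omega>) \<inter> slit l (x1, x2))"
  note [measurable] = isolates_measurable[OF P] point_measurable[OF P] Suc.IH
  have eq: "?R (Suc k) q \<omega> \<longleftrightarrow> isolates q (P ?i \<omega>) \<and>
      (\<exists>p. ?R k p \<omega> \<and> (\<forall>s. isolates s (P ?j \<omega>) \<longrightarrow>
         \<bar>point q (P ?i \<omega>) - point p (P ?j \<omega>)\<bar> \<le> \<bar>point q (P ?i \<omega>) - point s (P ?j \<omega>)\<bar>))"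
    if "\<omega> \<in> space M" for \<omega>
  proof -
    have lf: "locally_finite (P i \<omega>)" for i
      using measurable_space[OF P that] by (simp add: space_configurations)
    note pts = locally_finite_eq_points[OF lf]
    have edge: "((?i, u), w) \<in> edges (?c \<omega>) \<longleftrightarrow>
        u \<in> P ?i \<omega> \<and> (\<exists>p. isolates p (P ?j \<omega>) \<and> w = (?j, point p (P ?j \<omega>)) \<and>
          (\<forall>s. isolates s (P ?j \<omega>) \<longrightarrow> \<bar>u - point p (P ?j \<omega>)\<bar> \<le> \<bar>u - point s (P ?j \<omega>)\<bar>))" for u w
    proof -
      obtain a b where w: "w = (a, b)" by fastforce
      have j: "?i - 1 = ?j" by simp
      have "((?i, u), w) \<in> edges (?c \<omega>) \<longleftrightarrow>
          u \<in> P ?i \<omega> \<and> b \<in> P ?j \<omega> \<and> a = ?j \<and> (\<forall>z. z \<in> P ?j \<omega> \<longrightarrow> \<bar>u - b\<bar> \<le> \<bar>u - z\<bar>)"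
        unfolding edges_def nodes_def w mem_Collect_eq case_prod_conv j by blast
      then show ?thesis unfolding pts[of _ ?j] w by blast
    qed
    have step: "((?i, u), z) \<in> edges (?c \<omega>) ^^ Suc k \<longleftrightarrow>
        (\<exists>w. ((?i, u), w) \<in> edges (?c \<omega>) \<and> (w, z) \<in> edges (?c \<omega>) ^^ k)" for u z
      by (meson relpow_Suc_D2 relpow_Suc_I2)
    have "isolates q (P ?i \<omega>) \<Longrightarrow> point q (P ?i \<omega>) \<in> P ?i \<omega>"
      unfolding pts by blast
    then show ?thesis
      unfolding step edge by blast
  qed
  have "Measurable.pred M (\<lambda>\<omega>. isolates q (P ?i \<omega>) \<and>
      (\<exists>p. ?R k p \<omega> \<and> (\<forall>s. isolates s (P ?j \<omega>) \<longrightarrow>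
         \<bar>point q (P ?i \<omega>) - point p (P ?j \<omega>)\<bar> \<le> \<bar>point q (P ?i \<omega>) - point s (P ?j \<omega>)\<bar>)))"
    by measurable
  then show ?case by (subst measurable_cong[OF eq])
qed

lemma edges_relpow_fst: "(y, z) \<in> edges c ^^ k \<Longrightarrow> fst y = fst z + int k"
proof (induction k arbitrary: z)
  case (Suc k)
  then obtain w where "(y, w) \<in> edges c ^^ k" "(w, z) \<in> edges c" by auto
  moreover from this(2) have "fst w = fst z + 1" by (auto simp: edges_def)
  ultimately show ?case using Suc.IH by simp
qed simp

lemma tau_ge_enat_iff:
  assumes "n \<noteq> 0"
  shows "enat n \<le> tau c l x \<longleftrightarrow>
    (\<exists>k y z. n \<le> k + 1 \<and> y \<in> nodes c \<and> z \<in> nodes c \<inter> slit l x \<and> (y, z) \<in> edges c ^^ k)"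
    (is "_ \<longleftrightarrow> ?R")
proof
  assume n: "enat n \<le> tau c l x"
  have "enat (n - 1) < enat n" using assms by simp
  also note n
  finally obtain k y z where "enat (n - 1) < enat (k + 1)" "y \<in> nodes c"
    "z \<in> nodes c \<inter> slit l x" "(y, z) \<in> edges c ^^ k"
    unfolding tau_def less_Sup_iff by blast
  moreover from this have "n \<le> k + 1" by simp
  ultimately show ?R by blast
next
  assume ?R
  then obtain k y z where "n \<le> k + 1" "y \<in> nodes c" "z \<in> nodes c \<inter> slit l x" "(y, z) \<in> edges c ^^ k"
    by blast
  moreover from this have "enat (k + 1) \<le> tau c l x"
    unfolding tau_def by (intro Sup_upper) blast
  ultimately show "enat n \<le> tau c l x" by (meson enat_ord_simps(1) order_trans)
qed

lemma tau_event_measurable: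
  assumes P: "\<And>i. P i \<in> measurable M configurations"
  shows "{\<omega> \<in> space M. ereal r \<le> ereal_of_enat (tau (\<lambda>i. P i \<omega>) l x)} \<in> sets M"
proof (cases "r \<le> 0")
  case True
  then have "ereal r \<le> ereal_of_enat t" for t
    by (cases t) auto
  then show ?thesis by simp
next
  case False
  obtain x1 x2 where x: "x = (x1, x2)" by fastforce
  define n where "n = nat \<lceil>r\<rceil>"
  have n: "n \<noteq> 0" using False by (simp add: n_def)
  have r: "ereal r \<le> ereal_of_enat t \<longleftrightarrow> enat n \<le> t" for t
    using False by (cases t) (auto simp: n_def nat_le_iff ceiling_le_iff)
  let ?R = "\<lambda>k q \<omega>. isolates q (P (x1 + int k) \<omega>) \<and>
    (\<exists>z. ((x1 + int k, point q (P (x1 + int k) \<omega>)), z) \<in> edges (\<lambda>i. P i \<omega>) ^^ k \<and>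
         z \<in> nodes (\<lambda>i. P i \<omega>) \<inter> slit l (x1, x2))"
  have eq: "ereal r \<le> ereal_of_enat (tau (\<lambda>i. P i \<omega>) l x) \<longleftrightarrow> (\<exists>k q. n \<le> k + 1 \<and> ?R k q \<omega>)"
    if "\<omega> \<in> space M" for \<omega>
  proof -
    have pts: "y \<in> P i \<omega> \<longleftrightarrow> (\<exists>q. isolates q (P i \<omega>) \<and> y = point q (P i \<omega>))" for y i
      using measurable_space[OF P that]
      by (intro locally_finite_eq_points) (simp add: space_configurations)
    show ?thesis unfolding r tau_ge_enat_iff[OF n]
    proof
      assume "\<exists>k y z. n \<le> k + 1 \<and> y \<in> nodes (\<lambda>i. P i \<omega>) \<and>
        z \<in> nodes (\<lambda>i. P i \<omega>) \<inter> slit l x \<and> (y, z) \<in> edges (\<lambda>i. P i \<omega>) ^^ k"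
      then obtain k y z where *: "n \<le> k + 1" "y \<in> nodes (\<lambda>i. P i \<omega>)"
        "z \<in> nodes (\<lambda>i. P i \<omega>) \<inter> slit l x" "(y, z) \<in> edges (\<lambda>i. P i \<omega>) ^^ k" by blast
      have "fst y = x1 + int k" using edges_relpow_fst[OF *(4)] *(3) by (auto simp: slit_def x)
      moreover obtain q where "isolates q (P (fst y) \<omega>)" "snd y = point q (P (fst y) \<omega>)"
        using *(2) pts by (auto simp: nodes_def)
      ultimately have "?R k q \<omega>" using *(3,4) unfolding x by (cases y, cases z) auto
      with *(1) show "\<exists>k q. n \<le> k + 1 \<and> ?R k q \<omega>" by blast
    next
      assume "\<exists>k q. n \<le> k + 1 \<and> ?R k q \<omega>"
      then obtain k q where *: "n \<le> k + 1" "?R k q \<omega>" by blast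
      moreover have "(x1 + int k, point q (P (x1 + int k) \<omega>)) \<in> nodes (\<lambda>i. P i \<omega>)"
        using *(2) unfolding nodes_def mem_Collect_eq case_prod_conv pts by blast
      ultimately show "\<exists>k y z. n \<le> k + 1 \<and> y \<in> nodes (\<lambda>i. P i \<omega>) \<and>
        z \<in> nodes (\<lambda>i. P i \<omega>) \<inter> slit l x \<and> (y, z) \<in> edges (\<lambda>i. P i \<omega>) ^^ k"
        unfolding x by blast
    qed
  qed
  note [measurable] = reach_measurable[OF P]
  have "Measurable.pred M (\<lambda>\<omega>. \<exists>k q. n \<le> k + 1 \<and> ?R k q \<omega>)" by measurable
  then have "Measurable.pred M (\<lambda>\<omega>. ereal r \<le> ereal_of_enat (tau (\<lambda>i. P i \<omega>) l x))"
    by (subst measurable_cong[OF eq])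
  then show ?thesis by simp
qed

end

theory Submission
  imports Defs "HOL-Real_Asymp.Real_Asymp"
begin

text \<open>
  The argument follows the slit backwards in time. Let \<open>J\<^sub>0\<close> be the slit, seen as an interval on column
  \<open>i\<close>, and let \<open>J\<^sub>j\<^sub>+\<^sub>1\<close> be the set of real numbers whose nearest point on column \<open>i + j\<close> lies in
  \<open>J\<^sub>j\<close>. This is again an interval (\<open>basin\<close>), which is a union of Voronoi cells, or it is
  empty. A node of column \<open>i + k\<close> whose path enters the slit lies in \<open>J\<^sub>k\<close>; hence
  \<open>\<tau> \<ge> n\<close> forces \<open>J\<^sub>n\<close> to be nonempty (\<open>long_path_survival\<close>).

  The interval \<open>J\<^sub>j\<close> is a function of the columns \<open>i, \<dots>, i + j - 1\<close>, so it is independent of the column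
  \<open>i + j\<close> that determines the next one, and its length is a Markov chain absorbed at \<open>0\<close>. By vertical
  homogeneity the length is a martingale (\<open>mean_basin_length\<close>). It also fluctuates: whatever
  the current length \<open>x\<close>, with a probability bounded below the next length is at most
  \<open>max 0 (x - 1)\<close> (\<open>basin_shrinks\<close>, \<open>prob_shrinking\<close>). A nonnegative martingale
  started at \<open>L\<close> whose increments do not degenerate before absorption survives \<open>k\<close> steps with
  probability of order \<open>L / sqrt k\<close>.

  To prove this last fact, fix \<open>m = sqrt k\<close> and use the bounded function \<open>potential m\<close>, which is
  \<open>1 + m\<^sup>2 - (m - x)\<^sup>2\<close> on \<open>(0, m]\<close>, constant beyond \<open>m\<close>, and \<open>0\<close> at \<open>0\<close>. The concave part loses the
  conditional variance in each step; the jump at \<open>0\<close> pays for the steps at which the length is so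
  small that its variance is small, because then absorption itself is likely. So the
  expected potential drops by a constant times \<open>P(0 < |J\<^sub>j| \<le> m)\<close> (\<open>expected_potential_decreases\<close>).
  It starts below \<open>2 m L + 1\<close>, which bounds the sum over \<open>j < k\<close> of these probabilities by a multiple of
  \<open>m L\<close>; the value of the potential beyond \<open>m\<close> gives \<open>P(|J\<^sub>j| > m) \<le> (2 m L + 1) / m\<^sup>2\<close>. Survival
  is monotone in time, so \<open>k\<close> times the survival probability at time \<open>k\<close> is at most the sum of
  both kinds of terms over \<open>j < k\<close>, which is of order \<open>sqrt k L\<close> (\<open>survival_bound\<close>).

  The only information about the Poisson processes that enters the one-step estimates is the
  probability that a bounded Borel set contains no point; all events in question are handled by
  inclusion and exclusion (locale \<open>void_law\<close>).
\<close>

section \<open>Neighbours in a locally finite set\<close>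

lemma Inf_in_locally_finite:
  assumes "locally_finite S" "A \<subseteq> S" "A \<noteq> {}" "bdd_below A"
  shows "Inf A \<in> A"
proof -
  obtain s where s: "s \<in> A" using assms(3) by blast
  obtain t where t: "\<And>u. u \<in> A \<Longrightarrow> t \<le> u" using assms(4) by (auto simp: bdd_below_def)
  have "A \<inter> {..s} \<subseteq> S \<inter> {t..s}" using assms(2) t by auto
  moreover have "finite (S \<inter> {t..s})" using assms(1) by (auto simp: locally_finite_def)
  ultimately have fin: "finite (A \<inter> {..s})" by (rule finite_subset)
  have ne: "A \<inter> {..s} \<noteq> {}" using s by auto
  have "Min (A \<inter> {..s}) \<in> A" using Min_in[OF fin ne] by simp
  moreover have "Min (A \<inter> {..s}) \<le> u" if "u \<in> A" for u
  proof (cases "u \<le> s")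
    case False
    have "Min (A \<inter> {..s}) \<le> s" using s fin by (intro Min_le) auto
    with False show ?thesis by simp
  qed (use that fin in \<open>auto intro: Min_le\<close>)
  ultimately have "Inf A = Min (A \<inter> {..s})" by (intro cInf_eq_minimum)
  with \<open>Min (A \<inter> {..s}) \<in> A\<close> show ?thesis by simp
qed

lemma Sup_in_locally_finite:
  assumes "locally_finite S" "A \<subseteq> S" "A \<noteq> {}" "bdd_above A"
  shows "Sup A \<in> A"
proof -
  have "locally_finite (uminus ` S)"
    unfolding locally_finite_def
  proof (intro allI impI)
    fix B :: "real set" assume "bounded B"
    then have "finite (S \<inter> uminus ` B)"
      using assms(1) by (simp add: locally_finite_def)
    then have "finite (uminus ` (S \<inter> uminus ` B))" by simp
    moreover have "uminus ` S \<inter> B \<subseteq> uminus ` (S \<inter> uminus ` B)" by force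
    ultimately show "finite (uminus ` S \<inter> B)" by (rule finite_subset[rotated])
  qed
  then have "Inf (uminus ` A) \<in> uminus ` A"
    using assms by (intro Inf_in_locally_finite[of "uminus ` S"]) auto
  moreover have "Inf (uminus ` A) = - Sup A"
    by (simp add: Inf_real_def image_image)
  ultimately show ?thesis by (auto simp: image_iff)
qed

text \<open>A locally finite set is enumerated by \<open>point\<close> over the countable set of
  rational intervals, so quantifiers over its points preserve measurability, even when the
  quantified property depends on further random quantities such as the end points of a random
  interval.\<close>

lemma Bex_points_measurable:
  assumes X: "X \<in> measurable N configurations"
    and Q: "\<And>q. Measurable.pred N (\<lambda>\<omega>. Q \<omega> (point q (X \<omega>)))"
  shows "Measurable.pred N (\<lambda>\<omega>. \<exists>s\<in>X \<omega>. Q \<omega> s)"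
proof -
  note [measurable] = Q isolates_measurable[OF X]
  have eq: "(\<exists>s\<in>X \<omega>. Q \<omega> s) \<longleftrightarrow> (\<exists>q. isolates q (X \<omega>) \<and> Q \<omega> (point q (X \<omega>)))"
    if "\<omega> \<in> space N" for \<omega>
  proof -
    have "locally_finite (X \<omega>)"
      using measurable_space[OF X that] by (simp add: space_configurations)
    from locally_finite_eq_points[OF this] show ?thesis by metis
  qed
  have "Measurable.pred N (\<lambda>\<omega>. \<exists>q. isolates q (X \<omega>) \<and> Q \<omega> (point q (X \<omega>)))" by measurable
  then show ?thesis by (subst measurable_cong[OF eq])
qed

lemma Inf_points_measurable:
  assumes X: "X \<in> measurable N configurations"
    and Q: "\<And>q. Measurable.pred N (\<lambda>\<omega>. Q \<omega> (point q (X \<omega>)))"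
    and bdd: "\<And>\<omega>. bdd_below {s \<in> X \<omega>. Q \<omega> s}"
  shows "(\<lambda>\<omega>. Inf {s \<in> X \<omega>. Q \<omega> s}) \<in> borel_measurable N"
proof (rule borel_measurableI_less)
  fix y :: real
  have eq: "Inf {s \<in> X \<omega>. Q \<omega> s} < y \<longleftrightarrow>
      (\<exists>s\<in>X \<omega>. Q \<omega> s \<and> s < y) \<or> \<not> (\<exists>s\<in>X \<omega>. Q \<omega> s) \<and> Inf {} < y" for \<omega>
  proof (cases "{s \<in> X \<omega>. Q \<omega> s} = {}")
    case True
    then have "\<not> (\<exists>s\<in>X \<omega>. Q \<omega> s)" by blast
    with True show ?thesis by metis
  next
    case False
    then have "\<exists>s\<in>X \<omega>. Q \<omega> s" by blast
    moreover have "Inf {s \<in> X \<omega>. Q \<omega> s} < y \<longleftrightarrow> (\<exists>s\<in>X \<omega>. Q \<omega> s \<and> s < y)"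
      unfolding cInf_less_iff[OF False bdd] by blast
    ultimately show ?thesis by simp
  qed
  note [measurable] = Q point_measurable[OF X]
  have [measurable]: "Measurable.pred N (\<lambda>\<omega>. \<exists>s\<in>X \<omega>. Q \<omega> s \<and> s < y)"
    "Measurable.pred N (\<lambda>\<omega>. \<exists>s\<in>X \<omega>. Q \<omega> s)"
    by (intro Bex_points_measurable[OF X]; measurable)+
  show "{\<omega> \<in> space N. Inf {s \<in> X \<omega>. Q \<omega> s} < y} \<in> sets N"
    unfolding eq by measurable
qed

lemma Sup_points_measurable:
  assumes X: "X \<in> measurable N configurations"
    and Q: "\<And>q. Measurable.pred N (\<lambda>\<omega>. Q \<omega> (point q (X \<omega>)))"
    and bdd: "\<And>\<omega>. bdd_above {s \<in> X \<omega>. Q \<omega> s}"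
  shows "(\<lambda>\<omega>. Sup {s \<in> X \<omega>. Q \<omega> s}) \<in> borel_measurable N"
proof (rule borel_measurableI_greater)
  fix y :: real
  have eq: "y < Sup {s \<in> X \<omega>. Q \<omega> s} \<longleftrightarrow>
      (\<exists>s\<in>X \<omega>. Q \<omega> s \<and> y < s) \<or> \<not> (\<exists>s\<in>X \<omega>. Q \<omega> s) \<and> y < Sup {}" for \<omega>
  proof (cases "{s \<in> X \<omega>. Q \<omega> s} = {}")
    case True
    then have "\<not> (\<exists>s\<in>X \<omega>. Q \<omega> s)" by blast
    with True show ?thesis by metis
  next
    case False
    then have "\<exists>s\<in>X \<omega>. Q \<omega> s" by blast
    moreover have "y < Sup {s \<in> X \<omega>. Q \<omega> s} \<longleftrightarrow> (\<exists>s\<in>X \<omega>. Q \<omega> s \<and> y < s)"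
      unfolding less_cSup_iff[OF False bdd] by blast
    ultimately show ?thesis by simp
  qed
  note [measurable] = Q point_measurable[OF X]
  have [measurable]: "Measurable.pred N (\<lambda>\<omega>. \<exists>s\<in>X \<omega>. Q \<omega> s \<and> y < s)"
    "Measurable.pred N (\<lambda>\<omega>. \<exists>s\<in>X \<omega>. Q \<omega> s)"
    by (intro Bex_points_measurable[OF X]; measurable)+
  show "{\<omega> \<in> space N. y < Sup {s \<in> X \<omega>. Q \<omega> s}} \<in> sets N"
    unfolding eq by measurable
qed

text \<open>For an interval \<open>[a, b]\<close> these are the last point to its left, the first
  and the last point inside it, and the first point to its right. Points at \<open>a\<close> and
  \<open>b\<close> count as inside, as they do for the slit.\<close>

definition last_before :: "real \<Rightarrow> real set \<Rightarrow> real" where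
  "last_before a S = Sup {s \<in> S. s < a}"

definition first_from :: "real \<Rightarrow> real set \<Rightarrow> real" where
  "first_from a S = Inf {s \<in> S. a \<le> s}"

definition last_upto :: "real \<Rightarrow> real set \<Rightarrow> real" where
  "last_upto b S = Sup {s \<in> S. s \<le> b}"

definition first_beyond :: "real \<Rightarrow> real set \<Rightarrow> real" where
  "first_beyond b S = Inf {s \<in> S. b < s}"

definition unbounded_both_ways :: "real set \<Rightarrow> bool" where
  "unbounded_both_ways S \<longleftrightarrow> (\<forall>t. (\<exists>s\<in>S. s < t) \<and> (\<exists>s\<in>S. t < s))"

lemma last_before:
  assumes "locally_finite S" "unbounded_both_ways S"
  shows "last_before a S \<in> S" "last_before a S < a" "\<And>s. s \<in> S \<Longrightarrow> s < a \<Longrightarrow> s \<le> last_before a S"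
proof -
  have bdd: "bdd_above {s \<in> S. s < a}" by (rule bdd_aboveI[of _ a]) auto
  have "Sup {s \<in> S. s < a} \<in> {s \<in> S. s < a}"
    using assms bdd by (intro Sup_in_locally_finite[of S]) (auto simp: unbounded_both_ways_def)
  then show "last_before a S \<in> S" "last_before a S < a" by (auto simp: last_before_def)
  show "s \<le> last_before a S" if "s \<in> S" "s < a" for s
    using that bdd by (auto simp: last_before_def intro: cSup_upper)
qed

lemma first_from:
  assumes "locally_finite S" "unbounded_both_ways S"
  shows "first_from a S \<in> S" "a \<le> first_from a S" "\<And>s. s \<in> S \<Longrightarrow> a \<le> s \<Longrightarrow> first_from a S \<le> s"
proof -
  have bdd: "bdd_below {s \<in> S. a \<le> s}" by (rule bdd_belowI[of _ a]) auto
  have "{s \<in> S. a \<le> s} \<noteq> {}"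
    using assms(2) by (force simp: unbounded_both_ways_def dest: spec[of _ a])
  then have "Inf {s \<in> S. a \<le> s} \<in> {s \<in> S. a \<le> s}"
    using assms bdd by (intro Inf_in_locally_finite[of S]) auto
  then show "first_from a S \<in> S" "a \<le> first_from a S" by (auto simp: first_from_def)
  show "first_from a S \<le> s" if "s \<in> S" "a \<le> s" for s
    using that bdd by (auto simp: first_from_def intro: cInf_lower)
qed

lemma last_upto:
  assumes "locally_finite S" "unbounded_both_ways S"
  shows "last_upto b S \<in> S" "last_upto b S \<le> b" "\<And>s. s \<in> S \<Longrightarrow> s \<le> b \<Longrightarrow> s \<le> last_upto b S"
proof -
  have bdd: "bdd_above {s \<in> S. s \<le> b}" by (rule bdd_aboveI[of _ b]) auto
  have "{s \<in> S. s \<le> b} \<noteq> {}"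
    using assms(2) by (force simp: unbounded_both_ways_def dest: spec[of _ b])
  then have "Sup {s \<in> S. s \<le> b} \<in> {s \<in> S. s \<le> b}"
    using assms bdd by (intro Sup_in_locally_finite[of S]) auto
  then show "last_upto b S \<in> S" "last_upto b S \<le> b" by (auto simp: last_upto_def)
  show "s \<le> last_upto b S" if "s \<in> S" "s \<le> b" for s
    using that bdd by (auto simp: last_upto_def intro: cSup_upper)
qed

lemma first_beyond:
  assumes "locally_finite S" "unbounded_both_ways S"
  shows "first_beyond b S \<in> S" "b < first_beyond b S"
    "\<And>s. s \<in> S \<Longrightarrow> b < s \<Longrightarrow> first_beyond b S \<le> s"
proof -
  have bdd: "bdd_below {s \<in> S. b < s}" by (rule bdd_belowI[of _ b]) auto
  have "Inf {s \<in> S. b < s} \<in> {s \<in> S. b < s}"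
    using assms bdd by (intro Inf_in_locally_finite[of S]) (auto simp: unbounded_both_ways_def)
  then show "first_beyond b S \<in> S" "b < first_beyond b S" by (auto simp: first_beyond_def)
  show "first_beyond b S \<le> s" if "s \<in> S" "b < s" for s
    using that bdd by (auto simp: first_beyond_def intro: cInf_lower)
qed

text \<open>The numbers whose nearest point in \<open>S\<close> lies in the interval
  \<open>J\<close>: the boundaries are the midpoints between the extreme points inside
  \<open>J\<close> and their outer neighbours. The pair \<open>(0, 0)\<close> stands for the empty
  set; the test \<open>fst J < snd J\<close> makes it absorbing for every \<open>S\<close>, also if
  \<open>0 \<in> S\<close>.\<close>

definition basin :: "real \<times> real \<Rightarrow> real set \<Rightarrow> real \<times> real" where
  "basin J S = (if fst J < snd J \<and> S \<inter> {fst J..snd J} \<noteq> {}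
     then ((last_before (fst J) S + first_from (fst J) S) / 2,
           (last_upto (snd J) S + first_beyond (snd J) S) / 2)
     else (0, 0))"


lemma neighbour_measurable:
  assumes X [measurable]: "X \<in> measurable N configurations" and g [measurable]: "g \<in> borel_measurable N"
  shows last_before_measurable: "(\<lambda>\<omega>. last_before (g \<omega>) (X \<omega>)) \<in> borel_measurable N"
    and first_from_measurable: "(\<lambda>\<omega>. first_from (g \<omega>) (X \<omega>)) \<in> borel_measurable N"
    and last_upto_measurable: "(\<lambda>\<omega>. last_upto (g \<omega>) (X \<omega>)) \<in> borel_measurable N"
    and first_beyond_measurable: "(\<lambda>\<omega>. first_beyond (g \<omega>) (X \<omega>)) \<in> borel_measurable N"
proof -
  note [measurable] = point_measurable[OF X]
  have bdd: "bdd_above {s \<in> S. s < t}" "bdd_above {s \<in> S. s \<le> t}"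
    "bdd_below {s \<in> S. t \<le> s}" "bdd_below {s \<in> S. t < s}" for S and t :: real
    by (rule bdd_aboveI[of _ t] bdd_belowI[of _ t]; simp)+
  show "(\<lambda>\<omega>. last_before (g \<omega>) (X \<omega>)) \<in> borel_measurable N"
    unfolding last_before_def by (rule Sup_points_measurable[OF X _ bdd(1)]) measurable
  show "(\<lambda>\<omega>. first_from (g \<omega>) (X \<omega>)) \<in> borel_measurable N"
    unfolding first_from_def by (rule Inf_points_measurable[OF X _ bdd(3)]) measurable
  show "(\<lambda>\<omega>. last_upto (g \<omega>) (X \<omega>)) \<in> borel_measurable N"
    unfolding last_upto_def by (rule Sup_points_measurable[OF X _ bdd(2)]) measurable
  show "(\<lambda>\<omega>. first_beyond (g \<omega>) (X \<omega>)) \<in> borel_measurable N"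
    unfolding first_beyond_def by (rule Inf_points_measurable[OF X _ bdd(4)]) measurable
qed

lemma hit_measurable:
  assumes X [measurable]: "X \<in> measurable N configurations"
    and [measurable]: "g \<in> borel_measurable N" "h \<in> borel_measurable N"
  shows "Measurable.pred N (\<lambda>\<omega>. X \<omega> \<inter> {g \<omega>..h \<omega>} \<noteq> {})"
proof -
  note [measurable] = point_measurable[OF X]
  have "Measurable.pred N (\<lambda>\<omega>. \<exists>s\<in>X \<omega>. g \<omega> \<le> s \<and> s \<le> h \<omega>)"
    by (rule Bex_points_measurable[OF X]) measurable
  moreover have "(S \<inter> {u..v} \<noteq> {}) = (\<exists>s\<in>S. u \<le> s \<and> s \<le> v)" for S and u v :: real by auto
  ultimately show ?thesis by presburger
qed

lemma basin_measurable:
  assumes X: "X \<in> measurable N configurations"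
    and J [measurable]: "J \<in> N \<rightarrow>\<^sub>M borel \<Otimes>\<^sub>M borel"
  shows "(\<lambda>\<omega>. basin (J \<omega>) (X \<omega>)) \<in> N \<rightarrow>\<^sub>M borel \<Otimes>\<^sub>M borel"
proof -
  have ends [measurable]: "(\<lambda>\<omega>. fst (J \<omega>)) \<in> borel_measurable N" "(\<lambda>\<omega>. snd (J \<omega>)) \<in> borel_measurable N"
    by measurable
  note [measurable] = neighbour_measurable[OF X ends(1)] neighbour_measurable[OF X ends(2)]
    hit_measurable[OF X ends]
  show ?thesis unfolding basin_def by measurable
qed

text \<open>A node \<open>y\<close> in the interval is nearest to \<open>x\<close> only if
  \<open>x\<close> is on the same side as \<open>y\<close> of the midpoints to both outer
  neighbours; those midpoints are within the basin's boundaries. Ties are included, which matches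
  the convention for edges.\<close>

lemma nearest_point_in_basin:
  assumes S: "locally_finite S" "unbounded_both_ways S"
    and y: "y \<in> S" "a \<le> y" "y \<le> b" and ab: "a < b"
    and near: "\<And>z. z \<in> S \<Longrightarrow> \<bar>x - y\<bar> \<le> \<bar>x - z\<bar>"
  shows "fst (basin (a, b) S) \<le> x \<and> x \<le> snd (basin (a, b) S)"
proof -
  note before = last_before[OF S, where a = a] and from_a = first_from[OF S, where a = a]
    and upto = last_upto[OF S, where b = b] and beyond = first_beyond[OF S, where b = b]
  have "x \<le> (y + first_beyond b S) / 2"
    using near[OF beyond(1)] beyond(2) y by (auto simp: abs_real_def split: if_splits)
  moreover have "(last_before a S + y) / 2 \<le> x"
    using near[OF before(1)] before(2) y by (auto simp: abs_real_def split: if_splits)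
  ultimately show ?thesis
    using y ab from_a(3)[OF y(1,2)] upto(3)[OF y(1,3)] by (auto simp: basin_def)
qed

lemma basin_nonempty:
  assumes S: "locally_finite S" "unbounded_both_ways S"
    and y: "y \<in> S" "a \<le> y" "y \<le> b" and ab: "a < b"
  shows "fst (basin (a, b) S) < snd (basin (a, b) S)"
proof -
  note before = last_before[OF S, where a = a] and from_a = first_from[OF S, where a = a]
    and upto = last_upto[OF S, where b = b] and beyond = first_beyond[OF S, where b = b]
  have "first_from a S \<le> y" "y \<le> last_upto b S"
    using y from_a(3) upto(3) by auto
  with before(2) beyond(2) ab have "last_before a S + first_from a S < last_upto b S + first_beyond b S"
    using y by linarith
  with y ab show ?thesis by (auto simp: basin_def)
qed

section \<open>Void probabilities\<close>

text \<open>The layer-cake formula. It turns the expectations needed below into integrals of tail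
  probabilities, which are void probabilities of intervals.\<close>

lemma nn_integral_tail:
  assumes "sigma_finite_measure M" and [measurable]: "f \<in> borel_measurable M"
  shows "(\<integral>\<^sup>+x. ennreal (f x) \<partial>M)
    = (\<integral>\<^sup>+t. emeasure M {x \<in> space M. t < f x} * indicator {0..} t \<partial>lborel)"
proof -
  interpret sigma_finite_measure M by fact
  interpret pair_sigma_finite M lborel ..
  have "(\<integral>\<^sup>+x. ennreal (f x) \<partial>M)
      = (\<integral>\<^sup>+x. (\<integral>\<^sup>+t. indicator {x \<in> space M. t < f x} x * indicator {0..} t \<partial>lborel) \<partial>M)"
  proof (rule nn_integral_cong)
    fix x assume x: "x \<in> space M"
    have "(\<integral>\<^sup>+t. indicator {x \<in> space M. t < f x} x * indicator {0..} t \<partial>lborel)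
        = (\<integral>\<^sup>+t. indicator {0..<f x} t \<partial>lborel)"
      using x by (intro nn_integral_cong) (auto split: split_indicator)
    also have "\<dots> = ennreal (f x)" by (cases "0 \<le> f x") (auto simp: ennreal_neg)
    finally show "ennreal (f x)
        = (\<integral>\<^sup>+t. indicator {x \<in> space M. t < f x} x * indicator {0..} t \<partial>lborel)" ..
  qed
  also have "\<dots> = (\<integral>\<^sup>+t. (\<integral>\<^sup>+x. indicator {x \<in> space M. t < f x} x * indicator {0..} t \<partial>M) \<partial>lborel)"
    by (intro Fubini'[symmetric]) (simp add: indicator_def split_beta)
  also have "\<dots> = (\<integral>\<^sup>+t. emeasure M {x \<in> space M. t < f x} * indicator {0..} t \<partial>lborel)"
    by (intro nn_integral_cong) (simp add: nn_integral_multc)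
  finally show ?thesis .
qed

lemma (in prob_space) mean_of_exponential_tail:
  assumes [measurable]: "Z \<in> borel_measurable M" and pos: "AE x in M. 0 \<le> Z x" and "0 < r" "0 \<le> p"
    and tail: "\<And>u. 0 \<le> u \<Longrightarrow> prob {x \<in> space M. u < Z x} = p * exp (- r * u)"
  shows "has_bochner_integral M Z (p / r)"
proof (rule has_bochner_integral_nn_integral)
  have "(\<integral>\<^sup>+x. ennreal (Z x) \<partial>M)
      = (\<integral>\<^sup>+t. emeasure M {x \<in> space M. t < Z x} * indicator {0..} t \<partial>lborel)"
    by (rule nn_integral_tail) (auto simp: sigma_finite_measure_axioms)
  also have "\<dots> = (\<integral>\<^sup>+t. ennreal (p * exp (- r * t)) * indicator {0..} t \<partial>lborel)"
    by (intro nn_integral_cong) (auto simp: emeasure_eq_measure tail split: split_indicator)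
  also have "\<dots> = ennreal (0 - (- (p / r) * exp (- r * 0)))"
  proof (rule nn_integral_FTC_atLeast)
    show "((\<lambda>t. - (p / r) * exp (- r * t)) \<longlongrightarrow> 0) at_top"
    proof -
      have "((\<lambda>t. exp (- (r * t))) \<longlongrightarrow> 0) at_top"
        using \<open>0 < r\<close> by real_asymp
      from tendsto_mult_right_zero[OF this, of "- (p / r)"] show ?thesis by simp
    qed
    show "DERIV (\<lambda>t. - (p / r) * exp (- r * t)) t :> p * exp (- r * t)" for t
      using \<open>0 < r\<close> by (auto intro!: derivative_eq_intros)
  qed (use \<open>0 \<le> p\<close> in auto)
  finally show "(\<integral>\<^sup>+x. ennreal (Z x) \<partial>M) = ennreal (p / r)" by simp
qed (use assms in auto)

lemma (in prob_space) mean_of_truncated_exponential_tail: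
  assumes [measurable]: "Z \<in> borel_measurable M" and pos: "AE x in M. 0 \<le> Z x" and "0 < r" "0 \<le> d"
    and tail: "\<And>u. 0 \<le> u \<Longrightarrow> u \<le> d \<Longrightarrow> prob {x \<in> space M. u < Z x} = 1 - exp (- r * (d - u))"
    and bound: "AE x in M. Z x \<le> d"
  shows "has_bochner_integral M Z (d - (1 - exp (- r * d)) / r)"
proof (rule has_bochner_integral_nn_integral)
  have "(\<integral>\<^sup>+x. ennreal (Z x) \<partial>M)
      = (\<integral>\<^sup>+t. emeasure M {x \<in> space M. t < Z x} * indicator {0..} t \<partial>lborel)"
    by (rule nn_integral_tail) (auto simp: sigma_finite_measure_axioms)
  also have "\<dots> = (\<integral>\<^sup>+t. ennreal (1 - exp (- r * (d - t))) * indicator {0..d} t \<partial>lborel)"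
  proof (intro nn_integral_cong)
    fix t :: real
    have "emeasure M {x \<in> space M. t < Z x} = 0" if "d < t"
    proof (rule emeasure_eq_0_AE)
      show "AE x in M. \<not> t < Z x"
        using bound by eventually_elim (use that in auto)
    qed
    then show "emeasure M {x \<in> space M. t < Z x} * indicator {0..} t
        = ennreal (1 - exp (- r * (d - t))) * indicator {0..d} t"
      using tail[of t] by (auto simp: emeasure_eq_measure not_le split: split_indicator)
  qed
  also have "\<dots> = ennreal ((d - exp (- r * (d - d)) / r) - (0 - exp (- r * (d - 0)) / r))"
  proof (rule nn_integral_FTC_Icc)
    show "DERIV (\<lambda>t. t - exp (- r * (d - t)) / r) t :> 1 - exp (- r * (d - t))" for t
      using \<open>0 < r\<close> by (auto intro!: derivative_eq_intros)
    show "0 \<le> 1 - exp (- r * (d - t))" if "t \<in> {0..d}" for t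
      using that \<open>0 < r\<close> by auto
  qed (use \<open>0 \<le> d\<close> in auto)
  also have "(d - exp (- r * (d - d)) / r) - (0 - exp (- r * (d - 0)) / r) = d - (1 - exp (- r * d)) / r"
    by (simp add: diff_divide_distrib)
  finally show "(\<integral>\<^sup>+x. ennreal (Z x) \<partial>M) = ennreal (d - (1 - exp (- r * d)) / r)" .
  have "1 - r * d \<le> exp (- r * d)" using exp_ge_add_one_self[of "- r * d"] by simp
  then show "0 \<le> d - (1 - exp (- r * d)) / r" using \<open>0 < r\<close> by (simp add: field_simps)
qed (use assms in auto)

text \<open>The law of a random set for which a bounded Borel set \<open>B\<close> contains no
  point with the probability that a Poisson process of constant intensity \<open>r\<close> assigns.
  Joint laws of hitting and missing several disjoint sets follow by inclusion and exclusion.\<close>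

locale void_law = prob_space D for D :: "real set measure" +
  fixes r :: real
  assumes rate_pos: "0 < r"
    and sets_D [measurable_cong]: "sets D = sets configurations"
    and void: "\<And>B. B \<in> sets borel \<Longrightarrow> bounded B \<Longrightarrow>
      prob {S \<in> space D. S \<inter> B = {}} = exp (- r * measure lborel B)"
begin

lemma space_D: "space D = {S. locally_finite S}"
  using sets_eq_imp_space_eq[OF sets_D] by (simp add: space_configurations)

lemma void_event:
  assumes "B \<in> sets borel" "bounded B"
  shows "Measurable.pred D (\<lambda>S. S \<inter> B = {})"
proof -
  have "{S \<in> space configurations. card (S \<inter> B) = 0} \<in> sets D"
    unfolding sets_D by (rule count_sets[OF assms])
  moreover have "{S \<in> space configurations. card (S \<inter> B) = 0} = {S \<in> space D. S \<inter> B = {}}"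
    using assms(2) by (auto simp: space_D space_configurations locally_finite_def)
  ultimately show ?thesis by (simp add: pred_def)
qed

lemma void_interval [measurable]:
  "Measurable.pred D (\<lambda>S. S \<inter> {u<..v} = {})" "Measurable.pred D (\<lambda>S. S \<inter> {u..<v} = {})"
  "Measurable.pred D (\<lambda>S. S \<inter> {u..v} = {})"
  by (rule void_event; simp)+

lemma void_hit:
  assumes A: "A \<in> sets borel" "bounded A" and B: "B \<in> sets borel" "bounded B" and "A \<inter> B = {}"
  shows "prob {S \<in> space D. S \<inter> A = {} \<and> S \<inter> B \<noteq> {}}
    = exp (- r * measure lborel A) * (1 - exp (- r * measure lborel B))"
proof -
  have AB: "A \<union> B \<in> sets borel" "bounded (A \<union> B)" using A B by auto
  note [measurable] = void_event[OF A] void_event[OF B] void_event[OF AB]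
  have fin: "emeasure lborel A \<noteq> \<infinity>" "emeasure lborel B \<noteq> \<infinity>"
    using A B by (auto dest: emeasure_bounded_finite)
  have "prob {S \<in> space D. S \<inter> A = {}} - prob {S \<in> space D. S \<inter> (A \<union> B) = {}}
      = prob ({S \<in> space D. S \<inter> A = {}} - {S \<in> space D. S \<inter> (A \<union> B) = {}})"
    by (subst finite_measure_Diff) auto
  also have "{S \<in> space D. S \<inter> A = {}} - {S \<in> space D. S \<inter> (A \<union> B) = {}}
      = {S \<in> space D. S \<inter> A = {} \<and> S \<inter> B \<noteq> {}}" by auto
  also have "prob {S \<in> space D. S \<inter> A = {}} = exp (- r * measure lborel A)"
    using A by (rule void)
  also have "prob {S \<in> space D. S \<inter> (A \<union> B) = {}} = exp (- r * measure lborel (A \<union> B))"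
    using AB by (rule void)
  also have "measure lborel (A \<union> B) = measure lborel A + measure lborel B"
    using A B \<open>A \<inter> B = {}\<close> fin by (intro measure_Union) auto
  finally have "prob {S \<in> space D. S \<inter> A = {} \<and> S \<inter> B \<noteq> {}}
      = exp (- r * measure lborel A) - exp (- r * (measure lborel A + measure lborel B))" ..
  then show ?thesis by (simp add: distrib_left exp_diff exp_minus field_simps)
qed

lemma void_hit_hit:
  assumes A: "A \<in> sets borel" "bounded A" and B: "B \<in> sets borel" "bounded B"
    and C: "C \<in> sets borel" "bounded C" and disj: "A \<inter> B = {}" "A \<inter> C = {}" "B \<inter> C = {}"
  shows "prob {S \<in> space D. S \<inter> A = {} \<and> S \<inter> B \<noteq> {} \<and> S \<inter> C \<noteq> {}}
    = exp (- r * measure lborel A) * (1 - exp (- r * measure lborel B)) * (1 - exp (- r * measure lborel C))"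
proof -
  note [measurable] = void_event[OF A] void_event[OF B] void_event[OF C]
  have fin: "emeasure lborel A \<noteq> \<infinity>" "emeasure lborel C \<noteq> \<infinity>"
    using A C by (auto dest: emeasure_bounded_finite)
  have AC: "A \<union> C \<in> sets borel" "bounded (A \<union> C)" using A C by auto
  note [measurable] = void_event[OF AC]
  have "prob {S \<in> space D. S \<inter> A = {} \<and> S \<inter> B \<noteq> {}} - prob {S \<in> space D. S \<inter> (A \<union> C) = {} \<and> S \<inter> B \<noteq> {}}
      = prob ({S \<in> space D. S \<inter> A = {} \<and> S \<inter> B \<noteq> {}} - {S \<in> space D. S \<inter> (A \<union> C) = {} \<and> S \<inter> B \<noteq> {}})"
    by (subst finite_measure_Diff) auto
  also have "{S \<in> space D. S \<inter> A = {} \<and> S \<inter> B \<noteq> {}} - {S \<in> space D. S \<inter> (A \<union> C) = {} \<and> S \<inter> B \<noteq> {}}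
      = {S \<in> space D. S \<inter> A = {} \<and> S \<inter> B \<noteq> {} \<and> S \<inter> C \<noteq> {}}" by auto
  also have "prob {S \<in> space D. S \<inter> A = {} \<and> S \<inter> B \<noteq> {}} = exp (- r * measure lborel A) * (1 - exp (- r * measure lborel B))"
    using A B disj by (intro void_hit)
  also have "prob {S \<in> space D. S \<inter> (A \<union> C) = {} \<and> S \<inter> B \<noteq> {}}
      = exp (- r * measure lborel (A \<union> C)) * (1 - exp (- r * measure lborel B))"
    using AC B disj by (intro void_hit) auto
  also have "measure lborel (A \<union> C) = measure lborel A + measure lborel C"
    using A C disj fin by (intro measure_Union) auto
  finally show ?thesis by (simp add: exp_add[symmetric] algebra_simps)
qed

text \<open>A half-line contains arbitrarily long intervals, and these are empty with arbitrarily
  small probability.\<close>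

lemma AE_unbounded_both_ways: "AE S in D. unbounded_both_ways S"
proof -
  have null: "AE S in D. S \<inter> U \<noteq> {}" if U: "\<And>n::nat. \<exists>t. {t..t + real n} \<subseteq> U" for U
  proof -
    obtain t where t: "\<And>n::nat. {t n..t n + real n} \<subseteq> U" using U by metis
    define E where "E n = {S \<in> space D. S \<inter> {t n..t n + real n} = {}}" for n
    have [measurable]: "E n \<in> sets D" for n
      unfolding E_def by measurable
    have "(\<lambda>n. exp (- r * real n)) \<longlonglongrightarrow> 0" using rate_pos by real_asymp
    have "prob (\<Inter>n. E n) \<le> exp (- r * real n)" for n
    proof -
      have "prob (\<Inter>n. E n) \<le> prob (E n)" by (intro finite_measure_mono) auto
      also have "\<dots> = exp (- r * real n)" unfolding E_def by (subst void) auto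
      finally show ?thesis .
    qed
    with \<open>(\<lambda>n. exp (- r * real n)) \<longlonglongrightarrow> 0\<close> have "prob (\<Inter>n. E n) \<le> 0"
      by (intro LIMSEQ_le_const) auto
    then have "emeasure D (\<Inter>n. E n) = 0" by (simp add: emeasure_eq_measure measure_le_0_iff)
    then have "AE S in D. S \<notin> (\<Inter>n. E n)" by (intro AE_not_in) (auto simp: null_sets_def)
    then show ?thesis
      by (rule AE_mp) (intro AE_I2, use t in \<open>fastforce simp: E_def\<close>)
  qed
  have "AE S in D. S \<inter> {..<real_of_int k} \<noteq> {} \<and> S \<inter> {real_of_int k<..} \<noteq> {}" for k
  proof (rule AE_conjI; rule null)
    show "\<exists>t. {t..t + real n} \<subseteq> {..<real_of_int k}" for n :: nat
      by (rule exI[of _ "real_of_int k - real n - 1"]) auto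
    show "\<exists>t. {t..t + real n} \<subseteq> {real_of_int k<..}" for n :: nat
      by (rule exI[of _ "real_of_int k + 1"]) auto
  qed
  then have "AE S in D. \<forall>k. S \<inter> {..<real_of_int k} \<noteq> {} \<and> S \<inter> {real_of_int k<..} \<noteq> {}"
    unfolding AE_all_countable by blast
  then show ?thesis
  proof eventually_elim
    case (elim S)
    show ?case unfolding unbounded_both_ways_def
    proof (intro allI conjI)
      fix t :: real
      obtain s where "s \<in> S" "s < real_of_int \<lfloor>t\<rfloor>" using elim[rule_format, of "\<lfloor>t\<rfloor>"] by auto
      moreover have "real_of_int \<lfloor>t\<rfloor> \<le> t" by simp
      ultimately show "\<exists>s\<in>S. s < t" by (meson less_le_trans)
      obtain s where "s \<in> S" "real_of_int \<lceil>t\<rceil> < s" using elim[rule_format, of "\<lceil>t\<rceil>"] by auto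
      moreover have "t \<le> real_of_int \<lceil>t\<rceil>" by simp
      ultimately show "\<exists>s\<in>S. t < s" by (meson le_less_trans)
    qed
  qed
qed

end

section \<open>One step of the dual interval\<close>

definition length_of :: "real \<times> real \<Rightarrow> real" where
  "length_of J = snd J - fst J"

context void_law begin

lemma AE_regular: "AE S in D. locally_finite S \<and> unbounded_both_ways S"
  using AE_unbounded_both_ways AE_space by eventually_elim (auto simp: space_D)

lemma prob_cong_regular:
  assumes "Measurable.pred D Q" "Measurable.pred D R"
    and "\<And>S. locally_finite S \<Longrightarrow> unbounded_both_ways S \<Longrightarrow> Q S \<longleftrightarrow> R S"
  shows "prob {S \<in> space D. Q S} = prob {S \<in> space D. R S}"
proof (rule measure_eq_AE)
  show "AE S in D. S \<in> {S \<in> space D. Q S} \<longleftrightarrow> S \<in> {S \<in> space D. R S}"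
    using AE_regular by eventually_elim (use assms(3) in auto)
qed (use assms(1,2) in \<open>auto simp: pred_def\<close>)

lemma id_measurable: "(\<lambda>S. S) \<in> measurable D configurations"
  by measurable

lemmas neighbour_measurable_D [measurable] =
  last_before_measurable[OF id_measurable borel_measurable_const]
  first_from_measurable[OF id_measurable borel_measurable_const]
  last_upto_measurable[OF id_measurable borel_measurable_const]
  first_beyond_measurable[OF id_measurable borel_measurable_const]

text \<open>The basin consists of two outer gaps and two inner distances, whose means are computed
  separately. The distance from the interval to the first point outside is exponential and
  independent of the configuration inside.\<close>

lemma mean_gap_right:
  assumes "a \<le> b"
  shows "has_bochner_integral D (\<lambda>S. if S \<inter> {a..b} \<noteq> {} then first_beyond b S - b else 0)
    ((1 - exp (- r * (b - a))) / r)"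
proof (rule mean_of_exponential_tail)
  show "AE S in D. 0 \<le> (if S \<inter> {a..b} \<noteq> {} then first_beyond b S - b else 0)"
    using AE_regular by eventually_elim (simp add: first_beyond(2) less_imp_le)
next
  fix u :: real assume u: "0 \<le> u"
  have "prob {S \<in> space D. u < (if S \<inter> {a..b} \<noteq> {} then first_beyond b S - b else 0)}
      = prob {S \<in> space D. S \<inter> {b<..b + u} = {} \<and> S \<inter> {a..b} \<noteq> {}}"
  proof (rule prob_cong_regular)
    fix S assume S: "locally_finite S" "unbounded_both_ways S"
    have "u < first_beyond b S - b \<longleftrightarrow> S \<inter> {b<..b + u} = {}"
      using first_beyond[OF S, where b = b] by force
    then show "u < (if S \<inter> {a..b} \<noteq> {} then first_beyond b S - b else 0)
        \<longleftrightarrow> S \<inter> {b<..b + u} = {} \<and> S \<inter> {a..b} \<noteq> {}"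
      using u by auto
  qed measurable
  also have "\<dots> = exp (- r * measure lborel {b<..b + u}) * (1 - exp (- r * measure lborel {a..b}))"
    by (rule void_hit) auto
  also have "\<dots> = (1 - exp (- r * (b - a))) * exp (- r * u)"
    using assms u by simp
  finally show "prob {S \<in> space D. u < (if S \<inter> {a..b} \<noteq> {} then first_beyond b S - b else 0)}
      = (1 - exp (- r * (b - a))) * exp (- r * u)" .
qed (use assms rate_pos in auto)

lemma mean_gap_left:
  assumes "a \<le> b"
  shows "has_bochner_integral D (\<lambda>S. if S \<inter> {a..b} \<noteq> {} then a - last_before a S else 0)
    ((1 - exp (- r * (b - a))) / r)"
proof (rule mean_of_exponential_tail)
  show "AE S in D. 0 \<le> (if S \<inter> {a..b} \<noteq> {} then a - last_before a S else 0)"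
    using AE_regular by eventually_elim (simp add: last_before(2) less_imp_le)
next
  fix u :: real assume u: "0 \<le> u"
  have "prob {S \<in> space D. u < (if S \<inter> {a..b} \<noteq> {} then a - last_before a S else 0)}
      = prob {S \<in> space D. S \<inter> {a - u..<a} = {} \<and> S \<inter> {a..b} \<noteq> {}}"
  proof (rule prob_cong_regular)
    fix S assume S: "locally_finite S" "unbounded_both_ways S"
    have "u < a - last_before a S \<longleftrightarrow> S \<inter> {a - u..<a} = {}"
      using last_before[OF S, where a = a] by force
    then show "u < (if S \<inter> {a..b} \<noteq> {} then a - last_before a S else 0)
        \<longleftrightarrow> S \<inter> {a - u..<a} = {} \<and> S \<inter> {a..b} \<noteq> {}"
      using u by auto
  qed measurable
  also have "\<dots> = exp (- r * measure lborel {a - u..<a}) * (1 - exp (- r * measure lborel {a..b}))"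
    by (rule void_hit) auto
  also have "\<dots> = (1 - exp (- r * (b - a))) * exp (- r * u)"
    using assms u by simp
  finally show "prob {S \<in> space D. u < (if S \<inter> {a..b} \<noteq> {} then a - last_before a S else 0)}
      = (1 - exp (- r * (b - a))) * exp (- r * u)" .
qed (use assms rate_pos in auto)

lemma prob_hit:
  assumes "B \<in> sets borel" "bounded B"
  shows "prob {S \<in> space D. S \<inter> B \<noteq> {}} = 1 - exp (- r * measure lborel B)"
  using void_hit[of "{}" B] assms by simp

text \<open>The last point inside is further than \<open>u\<close> from the left end exactly if
  the rest of the interval is hit, so the means of the inner distances have the same correction term
  as the outer ones, with the opposite sign.\<close>

lemma mean_reach_right:
  assumes "a \<le> b"
  shows "has_bochner_integral D (\<lambda>S. if S \<inter> {a..b} \<noteq> {} then last_upto b S - a else 0)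
    ((b - a) - (1 - exp (- r * (b - a))) / r)"
proof (rule mean_of_truncated_exponential_tail)
  have "AE S in D. 0 \<le> (if S \<inter> {a..b} \<noteq> {} then last_upto b S - a else 0) \<and>
     (if S \<inter> {a..b} \<noteq> {} then last_upto b S - a else 0) \<le> b - a"
    using AE_regular
  proof eventually_elim
    case (elim S)
    then have S: "locally_finite S" "unbounded_both_ways S" by auto
    have "a \<le> last_upto b S" if "S \<inter> {a..b} \<noteq> {}"
    proof -
      obtain y where "y \<in> S" "a \<le> y" "y \<le> b" using \<open>S \<inter> {a..b} \<noteq> {}\<close> by auto
      with last_upto(3)[OF S this(1,3)] show ?thesis by linarith
    qed
    with assms last_upto(2)[OF S, of b] show ?case by auto
  qed
  then show "AE S in D. 0 \<le> (if S \<inter> {a..b} \<noteq> {} then last_upto b S - a else 0)"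
    and "AE S in D. (if S \<inter> {a..b} \<noteq> {} then last_upto b S - a else 0) \<le> b - a"
    by (eventually_elim, blast)+
next
  fix u :: real assume u: "0 \<le> u" "u \<le> b - a"
  have "prob {S \<in> space D. u < (if S \<inter> {a..b} \<noteq> {} then last_upto b S - a else 0)}
      = prob {S \<in> space D. S \<inter> {a + u<..b} \<noteq> {}}"
  proof (rule prob_cong_regular)
    fix S assume S: "locally_finite S" "unbounded_both_ways S"
    have "u < last_upto b S - a \<longleftrightarrow> S \<inter> {a + u<..b} \<noteq> {}"
      using last_upto[OF S, where b = b] by force
    moreover have "S \<inter> {a..b} \<noteq> {}" if "S \<inter> {a + u<..b} \<noteq> {}" using that u by force
    ultimately show "u < (if S \<inter> {a..b} \<noteq> {} then last_upto b S - a else 0)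
        \<longleftrightarrow> S \<inter> {a + u<..b} \<noteq> {}"
      using u by (auto split: if_splits)
  qed measurable
  also have "\<dots> = 1 - exp (- r * (b - a - u))"
    using u by (subst prob_hit) (auto simp: algebra_simps)
  finally show "prob {S \<in> space D. u < (if S \<inter> {a..b} \<noteq> {} then last_upto b S - a else 0)}
      = 1 - exp (- r * (b - a - u))" .
qed (use assms rate_pos in auto)

lemma mean_reach_left:
  assumes "a \<le> b"
  shows "has_bochner_integral D (\<lambda>S. if S \<inter> {a..b} \<noteq> {} then b - first_from a S else 0)
    ((b - a) - (1 - exp (- r * (b - a))) / r)"
proof (rule mean_of_truncated_exponential_tail)
  have "AE S in D. 0 \<le> (if S \<inter> {a..b} \<noteq> {} then b - first_from a S else 0) \<and>
     (if S \<inter> {a..b} \<noteq> {} then b - first_from a S else 0) \<le> b - a"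
    using AE_regular
  proof eventually_elim
    case (elim S)
    then have S: "locally_finite S" "unbounded_both_ways S" by auto
    have "first_from a S \<le> b" if "S \<inter> {a..b} \<noteq> {}"
    proof -
      obtain y where "y \<in> S" "a \<le> y" "y \<le> b" using \<open>S \<inter> {a..b} \<noteq> {}\<close> by auto
      with first_from(3)[OF S this(1,2)] show ?thesis by linarith
    qed
    with assms first_from(2)[OF S, of a] show ?case by auto
  qed
  then show "AE S in D. 0 \<le> (if S \<inter> {a..b} \<noteq> {} then b - first_from a S else 0)"
    and "AE S in D. (if S \<inter> {a..b} \<noteq> {} then b - first_from a S else 0) \<le> b - a"
    by (eventually_elim, blast)+
next
  fix u :: real assume u: "0 \<le> u" "u \<le> b - a"
  have "prob {S \<in> space D. u < (if S \<inter> {a..b} \<noteq> {} then b - first_from a S else 0)}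
      = prob {S \<in> space D. S \<inter> {a..<b - u} \<noteq> {}}"
  proof (rule prob_cong_regular)
    fix S assume S: "locally_finite S" "unbounded_both_ways S"
    have "u < b - first_from a S \<longleftrightarrow> S \<inter> {a..<b - u} \<noteq> {}"
      using first_from[OF S, where a = a] by force
    moreover have "S \<inter> {a..b} \<noteq> {}" if "S \<inter> {a..<b - u} \<noteq> {}" using that u by force
    ultimately show "u < (if S \<inter> {a..b} \<noteq> {} then b - first_from a S else 0)
        \<longleftrightarrow> S \<inter> {a..<b - u} \<noteq> {}"
      using u by (auto split: if_splits)
  qed measurable
  also have "\<dots> = 1 - exp (- r * (b - a - u))"
    using u by (subst prob_hit) (auto simp: algebra_simps)
  finally show "prob {S \<in> space D. u < (if S \<inter> {a..b} \<noteq> {} then b - first_from a S else 0)}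
      = 1 - exp (- r * (b - a - u))" .
qed (use assms rate_pos in auto)

text \<open>The martingale property. Twice the length of a nonempty basin is the sum of the two
  outer gaps and of the distances of the extreme inner points from the opposite ends, and the terms
  \<open>(1 - exp (- r * (b - a))) / r\<close> cancel.\<close>

lemma mean_basin_length:
  assumes "a < b"
  shows "has_bochner_integral D (\<lambda>S. length_of (basin (a, b) S)) (b - a)"
proof -
  have eq: "length_of (basin (a, b) S) =
      ((if S \<inter> {a..b} \<noteq> {} then first_beyond b S - b else 0) +
       (if S \<inter> {a..b} \<noteq> {} then a - last_before a S else 0) +
       (if S \<inter> {a..b} \<noteq> {} then last_upto b S - a else 0) +
       (if S \<inter> {a..b} \<noteq> {} then b - first_from a S else 0)) / 2" for S
    using assms by (simp add: basin_def length_of_def diff_divide_distrib add_divide_distrib)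
  have "has_bochner_integral D (\<lambda>S. length_of (basin (a, b) S))
    (((1 - exp (- r * (b - a))) / r + (1 - exp (- r * (b - a))) / r
     + ((b - a) - (1 - exp (- r * (b - a))) / r) + ((b - a) - (1 - exp (- r * (b - a))) / r)) / 2)"
    unfolding eq using assms
    by (intro has_bochner_integral_divide_zero has_bochner_integral_add
      mean_gap_right mean_gap_left mean_reach_right mean_reach_left) auto
  also have "(p + p + (b - a - p) + (b - a - p)) / 2 = b - a" for p by simp
  finally show ?thesis .
qed

lemma basin_length_nonneg:
  assumes "locally_finite S" "unbounded_both_ways S"
  shows "0 \<le> length_of (basin J S)"
proof (cases "fst J < snd J \<and> S \<inter> {fst J..snd J} \<noteq> {}")
  case True
  then obtain y where "y \<in> S" "fst J \<le> y" "y \<le> snd J" by auto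
  from basin_nonempty[OF assms this] True show ?thesis by (simp add: length_of_def)
qed (auto simp: basin_def length_of_def)

text \<open>The constants: the left boundary moves to the right of \<open>((a - 1) + (a + 1)) / 2
  = a\<close> and the right boundary to the left of \<open>((b - 3) + (b + 1)) / 2 = b - 1\<close>.
  Intersecting the forbidden region with \<open>[a, b]\<close> keeps it disjoint from the regions to
  be hit. If \<open>b - a < 1\<close>, the whole interval is forbidden and the basin is
  empty.\<close>

lemma basin_shrinks:
  assumes S: "locally_finite S" "unbounded_both_ways S"
    and inner: "S \<inter> ({a..b} \<inter> ({..a + 1} \<union> {b - 3..})) = {}"
    and left: "S \<inter> {a - 1..<a} \<noteq> {}" and right: "S \<inter> {b<..b + 1} \<noteq> {}"
  shows "length_of (basin (a, b) S) \<le> max 0 (b - a - 1)"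
proof (cases "a < b \<and> S \<inter> {a..b} \<noteq> {}")
  case True
  then obtain y where y: "y \<in> S" "a \<le> y" "y \<le> b" by auto
  have "a - 1 \<le> last_before a S" using left last_before(3)[OF S] by fastforce
  moreover have "first_beyond b S \<le> b + 1" using right first_beyond(3)[OF S] by fastforce
  moreover have "a + 1 < first_from a S"
    using inner first_from(1,2)[OF S, of a] first_from(3)[OF S y(1,2)] y(3) by fastforce
  moreover have "last_upto b S < b - 3"
    using inner last_upto(1,2)[OF S, of b] last_upto(3)[OF S y(1,3)] y(2) by fastforce
  ultimately have "(last_upto b S + first_beyond b S) / 2 - (last_before a S + first_from a S) / 2
      \<le> b - a - 1" by argo
  with True show ?thesis by (simp add: basin_def length_of_def)
qed (auto simp: basin_def length_of_def)

lemma prob_shrinking: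
  assumes "a \<le> b"
  shows "exp (- 4 * r) * (1 - exp (- r))\<^sup>2
   \<le> prob {S \<in> space D. S \<inter> ({a..b} \<inter> ({..a + 1} \<union> {b - 3..})) = {} \<and>
        S \<inter> {a - 1..<a} \<noteq> {} \<and> S \<inter> {b<..b + 1} \<noteq> {}}"
proof -
  have "measure lborel ({a..b} \<inter> ({..a + 1} \<union> {b - 3..})) \<le> measure lborel ({a..a + 1} \<union> {b - 3..b})"
    using emeasure_bounded_finite[of "{a..a + 1} \<union> {b - 3..b}"]
    by (intro measure_mono_fmeasurable) (auto simp: fmeasurable_def)
  also have "\<dots> \<le> measure lborel {a..a + 1} + measure lborel {b - 3..b}"
    by (intro measure_Un_le) auto
  also have "\<dots> = 4" by simp
  finally have "exp (- 4 * r) \<le> exp (- r * measure lborel ({a..b} \<inter> ({..a + 1} \<union> {b - 3..})))"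
    using rate_pos by simp
  then have "exp (- 4 * r) * (1 - exp (- r)) * (1 - exp (- r))
    \<le> exp (- r * measure lborel ({a..b} \<inter> ({..a + 1} \<union> {b - 3..}))) * (1 - exp (- r)) * (1 - exp (- r))"
    using rate_pos by (intro mult_right_mono) auto
  also have "\<dots> = prob {S \<in> space D. S \<inter> ({a..b} \<inter> ({..a + 1} \<union> {b - 3..})) = {} \<and>
        S \<inter> {a - 1..<a} \<noteq> {} \<and> S \<inter> {b<..b + 1} \<noteq> {}}"
    using assms by (subst void_hit_hit) (auto intro: bounded_subset[of "{a..b}"])
  finally show ?thesis by (simp add: power2_eq_square mult.assoc)
qed

lemma basin_measurable_D [measurable]: "(\<lambda>S. basin J S) \<in> D \<rightarrow>\<^sub>M borel \<Otimes>\<^sub>M borel"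
  by (rule basin_measurable[OF id_measurable]) (simp add: space_pair_measure)

end

text \<open>A truncated quadratic plus a unit jump at \<open>0\<close>.\<close>

definition potential :: "real \<Rightarrow> real \<Rightarrow> real" where
  "potential m x = (if 0 < x then m\<^sup>2 + 1 - (max 0 (m - x))\<^sup>2 else 0)"

lemma potential_measurable [measurable]: "potential m \<in> borel_measurable borel"
  unfolding potential_def by measurable

lemma length_of_measurable [measurable]: "length_of \<in> borel_measurable (borel \<Otimes>\<^sub>M borel)"
  unfolding length_of_def by measurable

lemma potential_bounds:
  assumes "0 \<le> m"
  shows "0 \<le> potential m x" "potential m x \<le> m\<^sup>2 + 1"
proof -
  have "(max 0 (m - x))\<^sup>2 \<le> m\<^sup>2" if "0 < x"
    using assms that by (intro power_mono) auto
  then show "0 \<le> potential m x" "potential m x \<le> m\<^sup>2 + 1"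
    by (auto simp: potential_def)
qed

text \<open>The potential lies below its tangent at \<open>x\<close>. If \<open>y\<close> is
  smaller than \<open>x\<close> by at least \<open>1\<close>, it lies below by \<open>(y -
  x)\<^sup>2 \<ge> 1\<close>; if \<open>y = 0\<close>, by \<open>x\<^sup>2 + 1\<close>, where the
  \<open>1\<close> comes from the jump.\<close>

lemma potential_tangent:
  assumes "0 < x" "x \<le> m" "0 \<le> y"
  shows "potential m y \<le> potential m x + 2 * (m - x) * (y - x)"
    and "y \<le> max 0 (x - 1) \<Longrightarrow> potential m y \<le> potential m x + 2 * (m - x) * (y - x) - 1"
proof -
  have x: "potential m x = m\<^sup>2 + 1 - (m - x)\<^sup>2" using assms by (simp add: potential_def max_def)
  have zero: "potential m y = 0" "potential m x + 2 * (m - x) * (y - x) = x\<^sup>2 + 1" if "y = 0"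
    using that unfolding x by (auto simp: potential_def power2_eq_square algebra_simps)
  have low: "potential m x + 2 * (m - x) * (y - x) - potential m y = (y - x)\<^sup>2" if "0 < y" "y \<le> m"
    using that unfolding x by (auto simp: potential_def max_def power2_eq_square algebra_simps)
  have high: "potential m x + 2 * (m - x) * (y - x) - potential m y = (m - x) * ((y - x) + (y - m))" if "m < y"
    using that assms unfolding x by (auto simp: potential_def max_def power2_eq_square algebra_simps)
  consider "y = 0" | "0 < y" "y \<le> m" | "m < y" using assms(3) by linarith
  then show "potential m y \<le> potential m x + 2 * (m - x) * (y - x)"
  proof cases
    case 1
    then show ?thesis using zero by simp
  next
    case 2
    then show ?thesis using low zero_le_power2[of "y - x"] by linarith
  next
    case 3
    have "0 \<le> (m - x) * ((y - x) + (y - m))" using 3 assms by (intro mult_nonneg_nonneg) auto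
    then show ?thesis using high[OF 3] by linarith
  qed
  assume y: "y \<le> max 0 (x - 1)"
  show "potential m y \<le> potential m x + 2 * (m - x) * (y - x) - 1"
  proof (cases "y = 0")
    case True
    then show ?thesis using zero by simp
  next
    case False
    then have y: "0 < y" "y \<le> x - 1" using y assms(3) by auto
    then have "1 \<le> (x - y)\<^sup>2" by (intro one_le_power) auto
    moreover have "(x - y)\<^sup>2 = (y - x)\<^sup>2" by (rule power2_commute)
    ultimately show ?thesis using low[OF y(1)] y assms(2) by linarith
  qed
qed

text \<open>The forbidden region has length at most \<open>4\<close>, and each of the two regions
  to be hit has length \<open>1\<close>.\<close>

definition shrink_bound :: "real \<Rightarrow> real" where
  "shrink_bound r = exp (- 4 * r) * (1 - exp (- r))\<^sup>2"

text \<open>For \<open>x \<le> m\<close> the linear term of the tangent has mean zero by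
  \<open>mean_basin_length\<close>, so what is left is the gain on the shrinking event. Beyond
  \<open>m\<close> the potential has its maximal value.\<close>

lemma (in void_law) potential_drift:
  assumes "0 \<le> m"
  shows "(\<integral>S. potential m (length_of (basin J S)) \<partial>D)
    \<le> potential m (length_of J) - shrink_bound r * indicator {0<..m} (length_of J)"
proof -
  obtain a b where J: "J = (a, b)" by fastforce
  have int: "integrable D (\<lambda>S. potential m (length_of (basin J S)))"
    by (rule integrable_const_bound[where B = "m\<^sup>2 + 1"]) (use potential_bounds[OF assms] in auto)
  consider "b \<le> a" | "a < b" "m < b - a" | "a < b" "b - a \<le> m" by linarith
  then show ?thesis
  proof cases
    case 1
    then have "basin J S = (0, 0)" for S by (simp add: J basin_def)
    with 1 show ?thesis by (simp add: J length_of_def potential_def)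
  next
    case 2
    have "(\<integral>S. potential m (length_of (basin J S)) \<partial>D) \<le> (\<integral>S. m\<^sup>2 + 1 \<partial>D)"
      using int potential_bounds[OF assms] by (intro integral_mono) auto
    also have "\<dots> = potential m (b - a)" using 2 by (simp add: potential_def prob_space)
    finally show ?thesis using 2 by (simp add: J length_of_def)
  next
    case 3
    \<comment> \<open>The event of \<open>basin_shrinks\<close>, on which the tangent bound has
      the extra gain of \<open>1\<close>.\<close>
    define Ev where "Ev S \<longleftrightarrow> S \<inter> ({a..b} \<inter> ({..a + 1} \<union> {b - 3..})) = {} \<and>
        S \<inter> {a - 1..<a} \<noteq> {} \<and> S \<inter> {b<..b + 1} \<noteq> {}" for S
    have [measurable]: "Measurable.pred D (\<lambda>S. S \<inter> ({a..b} \<inter> ({..a + 1} \<union> {b - 3..})) = {})"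
      by (rule void_event) (auto intro: bounded_subset[of "{a..b}"])
    have [measurable]: "Measurable.pred D Ev" unfolding Ev_def by measurable
    let ?x = "b - a"
    note mean = mean_basin_length[OF 3(1)]
    have int_len: "integrable D (\<lambda>S. length_of (basin J S))"
      and mean_len: "(\<integral>S. length_of (basin J S) \<partial>D) = ?x"
      using mean by (auto simp: J has_bochner_integral_iff)
    have int_ev: "integrable D (indicator {S \<in> space D. Ev S} :: _ \<Rightarrow> real)"
      by (rule integrable_const_bound[where B = 1]) auto
    have "(\<integral>S. potential m (length_of (basin J S)) \<partial>D)
      \<le> (\<integral>S. potential m ?x + 2 * (m - ?x) * (length_of (basin J S) - ?x)
             - indicator {S \<in> space D. Ev S} S \<partial>D)"
    proof (rule integral_mono_AE)
      show "AE S in D. potential m (length_of (basin J S)) \<le>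
          potential m ?x + 2 * (m - ?x) * (length_of (basin J S) - ?x) - indicator {S \<in> space D. Ev S} S"
        using AE_regular
      proof eventually_elim
        case (elim S)
        then have S: "locally_finite S" "unbounded_both_ways S" by auto
        have nonneg: "0 \<le> length_of (basin J S)" by (rule basin_length_nonneg[OF S])
        show ?case
        proof (cases "Ev S")
          case True
          then have "length_of (basin J S) \<le> max 0 (?x - 1)"
            unfolding J using basin_shrinks[OF S] by (auto simp: Ev_def)
          with potential_tangent(2)[OF _ 3(2) nonneg] 3(1) show ?thesis
            using True S by (simp add: space_D)
        next
          case False
          with potential_tangent(1)[OF _ 3(2) nonneg] 3(1) show ?thesis by simp
        qed
      qed
    qed (use int int_len int_ev in auto)
    also have "\<dots> = potential m ?x - prob {S \<in> space D. Ev S}"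
      using int_len int_ev by (simp add: mean_len prob_space)
    also have "\<dots> \<le> potential m ?x - shrink_bound r"
      using prob_shrinking[of a b] 3 by (simp add: shrink_bound_def Ev_def)
    finally show ?thesis using 3 by (simp add: J length_of_def)
  qed
qed

section \<open>The dual interval and its survival\<close>

primrec dual_interval :: "(int \<Rightarrow> real set) \<Rightarrow> int \<Rightarrow> real \<times> real \<Rightarrow> nat \<Rightarrow> real \<times> real" where
  "dual_interval c i J 0 = J"
| "dual_interval c i J (Suc j) = basin (dual_interval c i J j) (c (i + int j))"

text \<open>Read from its last node \<open>z\<close> backwards, each node of the path lies in the
  basin of the interval that contains its successor.\<close>

lemma path_in_dual_interval:
  assumes regular: "\<And>x. locally_finite (c x)" "\<And>x. unbounded_both_ways (c x)"
    and z: "z \<in> nodes c \<inter> slit L (i, t)" and "0 < L"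
    and path: "(y, z) \<in> edges c ^^ k"
  defines "J \<equiv> dual_interval c i (t - L / 2, t + L / 2)"
  shows "y \<in> nodes c \<and> fst (J k) \<le> snd y \<and> snd y \<le> snd (J k) \<and> 0 < length_of (J k)"
  using path
proof (induction k arbitrary: y)
  case 0
  then show ?case using z \<open>0 < L\<close> by (auto simp: J_def slit_def length_of_def)
next
  case (Suc k)
  from Suc.prems obtain w where yw: "(y, w) \<in> edges c" and wz: "(w, z) \<in> edges c ^^ k"
    by (meson relpow_Suc_D2)
  have IH: "w \<in> nodes c" "fst (J k) \<le> snd w" "snd w \<le> snd (J k)" "fst (J k) < snd (J k)"
    using Suc.IH[OF wz] by (auto simp: length_of_def)
  have w: "fst w = i + int k" using edges_relpow_fst[OF wz] z by (auto simp: slit_def)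
  have "snd w \<in> c (i + int k)" using IH(1) w by (auto simp: nodes_def)
  moreover have "y \<in> nodes c" "\<And>s. s \<in> c (i + int k) \<Longrightarrow> \<bar>snd y - snd w\<bar> \<le> \<bar>snd y - s\<bar>"
    using yw w by (auto simp: edges_def nodes_def)
  ultimately show ?case
    using nearest_point_in_basin[OF regular _ IH(2-4)] basin_nonempty[OF regular _ IH(2-4)]
    by (simp add: J_def length_of_def)
qed

text \<open>The first node of a path with \<open>k\<close> edges, hence \<open>k + 1\<close>
  nodes, is a point of column \<open>i + k\<close> inside the interval number \<open>k\<close>, so
  that one more basin is nonempty.\<close>

lemma long_path_survival:
  assumes regular: "\<And>x. locally_finite (c x)" "\<And>x. unbounded_both_ways (c x)"
    and z: "z \<in> nodes c \<inter> slit L (i, t)" and "0 < L"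
    and path: "(y, z) \<in> edges c ^^ k"
  shows "0 < length_of (dual_interval c i (t - L / 2, t + L / 2) (Suc k))"
proof -
  define J where "J = dual_interval c i (t - L / 2, t + L / 2)"
  have y: "y \<in> nodes c" "fst (J k) \<le> snd y" "snd y \<le> snd (J k)" "fst (J k) < snd (J k)"
    using path_in_dual_interval[OF assms] by (auto simp: J_def length_of_def)
  have "fst y = i + int k" using edges_relpow_fst[OF path] z by (auto simp: slit_def)
  with y(1) have "snd y \<in> c (i + int k)" by (auto simp: nodes_def)
  from basin_nonempty[OF regular this y(2-4)] show ?thesis
    by (simp add: J_def length_of_def)
qed

lemma dual_interval_survival_antimono:
  assumes "j \<le> k" "0 < length_of (dual_interval c i J k)"
  shows "0 < length_of (dual_interval c i J j)"
  using assms
proof (induction k)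
  case (Suc k)
  have "0 < length_of (dual_interval c i J k)"
    using Suc.prems(2) by (auto simp: length_of_def basin_def split: if_splits)
  with Suc show ?case by (cases "j = Suc k") auto
qed simp

lemma dual_interval_cong:
  assumes "\<And>x. i \<le> x \<Longrightarrow> x < i + int j \<Longrightarrow> c x = d x"
  shows "dual_interval c i J j = dual_interval d i J j"
  using assms by (induction j) auto

lemma dual_interval_measurable:
  assumes "\<And>x. i \<le> x \<Longrightarrow> x < i + int j \<Longrightarrow> (\<lambda>\<omega>. c \<omega> x) \<in> measurable N configurations"
  shows "(\<lambda>\<omega>. dual_interval (c \<omega>) i J j) \<in> N \<rightarrow>\<^sub>M borel \<Otimes>\<^sub>M borel"
  using assms
proof (induction j)
  case 0
  show ?case by (simp add: space_pair_measure)
next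
  case (Suc j)
  then show ?case by (auto intro!: basin_measurable)
qed

locale columns = prob_space M for M :: "'w measure" +
  fixes P :: "int \<Rightarrow> 'w \<Rightarrow> real set" and r :: "int \<Rightarrow> real" and lmin lmax :: real
  assumes law: "\<And>i. void_law (distr M configurations (P i)) (r i)"
    and indep: "indep_vars (\<lambda>_. configurations) P UNIV"
    and rate_bounds: "0 < lmin" "\<And>i. lmin \<le> r i" "\<And>i. r i \<le> lmax"
begin

lemma P_measurable [measurable]: "P i \<in> measurable M configurations"
  using indep by (auto simp: indep_vars_def)

lemma AE_regular_columns: "AE \<omega> in M. \<forall>i. locally_finite (P i \<omega>) \<and> unbounded_both_ways (P i \<omega>)"
  unfolding AE_all_countable
proof
  fix i
  show "AE \<omega> in M. locally_finite (P i \<omega>) \<and> unbounded_both_ways (P i \<omega>)"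
    by (rule AE_distrD[OF P_measurable void_law.AE_regular[OF law]])
qed

definition dual :: "int \<Rightarrow> real \<times> real \<Rightarrow> nat \<Rightarrow> 'w \<Rightarrow> real \<times> real" where
  "dual i J j \<omega> = dual_interval (\<lambda>x. P x \<omega>) i J j"

lemma dual_measurable [measurable]: "dual i J j \<in> M \<rightarrow>\<^sub>M borel \<Otimes>\<^sub>M borel"
  unfolding dual_def by (rule dual_interval_measurable) measurable

text \<open>The interval number \<open>j\<close> depends only on columns before \<open>i +
  j\<close>, so that column may be integrated out first with the interval held fixed. Independence
  is applied to the families of columns instead of to the interval itself because
  \<open>indep_var\<close> relates random variables with values in the same type.\<close>

lemma expectation_next_column:
  fixes f :: "real \<times> real \<Rightarrow> real set \<Rightarrow> real"
  assumes f: "(\<lambda>p. f (fst p) (snd p)) \<in> borel_measurable ((borel \<Otimes>\<^sub>M borel) \<Otimes>\<^sub>M configurations)"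
    and bound: "\<And>J S. norm (f J S) \<le> K"
  shows "expectation (\<lambda>\<omega>. f (dual i J j \<omega>) (P (i + int j) \<omega>))
    = expectation (\<lambda>\<omega>. \<integral>S. f (dual i J j \<omega>) S \<partial>distr M configurations (P (i + int j)))"
proof -
  let ?n = "i + int j" and ?S = "(borel \<Otimes>\<^sub>M borel) :: (real \<times> real) measure"
  let ?A = "PiM {i..<?n} (\<lambda>_. configurations)" and ?B = "PiM {?n} (\<lambda>_. configurations)"
  let ?R = "\<lambda>I \<omega>. restrict (\<lambda>x. P x \<omega>) I"
  let ?DA = "distr M ?A (?R {i..<?n})" and ?DB = "distr M ?B (?R {?n})"
  let ?g = "\<lambda>p. f (dual_interval (fst p) i J j) (snd p ?n)"
  have indep_AB: "indep_var ?A (?R {i..<?n}) ?B (?R {?n})"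
    by (rule indep_var_restrict[OF indep]) auto
  have [measurable]: "?R {i..<?n} \<in> M \<rightarrow>\<^sub>M ?A" "?R {?n} \<in> M \<rightarrow>\<^sub>M ?B"
    using indep_var_rv1[OF indep_AB] indep_var_rv2[OF indep_AB] .
  have D [measurable]: "(\<lambda>c. dual_interval c i J j) \<in> ?A \<rightarrow>\<^sub>M ?S"
    by (rule dual_interval_measurable) (auto intro: measurable_component_singleton)
  have [measurable]: "(\<lambda>c. c ?n) \<in> ?B \<rightarrow>\<^sub>M configurations"
    by (auto intro: measurable_component_singleton)
  have "(\<lambda>p. (dual_interval (fst p) i J j, snd p ?n)) \<in> ?A \<Otimes>\<^sub>M ?B \<rightarrow>\<^sub>M ?S \<Otimes>\<^sub>M configurations"
    by measurable
  from measurable_compose[OF this f] have g [measurable]: "?g \<in> borel_measurable (?A \<Otimes>\<^sub>M ?B)"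
    by simp
  interpret A: prob_space ?DA by (rule prob_space_distr) measurable
  interpret B: prob_space ?DB by (rule prob_space_distr) measurable
  interpret AB: pair_prob_space ?DA ?DB ..
  have int_g: "integrable (?DA \<Otimes>\<^sub>M ?DB) ?g"
    by (rule AB.integrable_const_bound[where B = K]) (use bound in auto)
  have dual_eq: "dual_interval (?R {i..<?n} \<omega>) i J j = dual i J j \<omega>" for \<omega>
    unfolding dual_def by (rule dual_interval_cong) auto
  have f_J [measurable]: "f I \<in> borel_measurable configurations" for I
    using measurable_compose[OF measurable_Pair1'[of I ?S] f] by (simp add: space_pair_measure)
  have "expectation (\<lambda>\<omega>. f (dual i J j \<omega>) (P ?n \<omega>)) = expectation (\<lambda>\<omega>. ?g (?R {i..<?n} \<omega>, ?R {?n} \<omega>))"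
    by (simp add: dual_eq)
  also have "\<dots> = (\<integral>p. ?g p \<partial>distr M (?A \<Otimes>\<^sub>M ?B) (\<lambda>\<omega>. (?R {i..<?n} \<omega>, ?R {?n} \<omega>)))"
    by (intro integral_distr[symmetric] g) measurable
  also have "distr M (?A \<Otimes>\<^sub>M ?B) (\<lambda>\<omega>. (?R {i..<?n} \<omega>, ?R {?n} \<omega>)) = ?DA \<Otimes>\<^sub>M ?DB"
    using indep_AB by (simp add: indep_var_distribution_eq)
  also have "(\<integral>p. ?g p \<partial>(?DA \<Otimes>\<^sub>M ?DB)) = (\<integral>c. (\<integral>d. ?g (c, d) \<partial>?DB) \<partial>?DA)"
    by (rule AB.integral_fst'[OF int_g, symmetric])
  also have "\<dots> = expectation (\<lambda>\<omega>. \<integral>d. ?g (?R {i..<?n} \<omega>, d) \<partial>?DB)"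
    using AB.integrable_fst'[OF int_g] by (intro integral_distr) auto
  also have "\<dots> = expectation (\<lambda>\<omega>. \<integral>S. f (dual i J j \<omega>) S \<partial>distr M configurations (P ?n))"
  proof (rule Bochner_Integration.integral_cong[OF refl])
    fix \<omega>
    have "(\<integral>d. ?g (?R {i..<?n} \<omega>, d) \<partial>?DB) = (\<integral>d. f (dual i J j \<omega>) (d ?n) \<partial>?DB)"
      by (simp add: dual_eq)
    also have "\<dots> = (\<integral>\<omega>'. f (dual i J j \<omega>) (P ?n \<omega>') \<partial>M)"
      by (subst integral_distr) auto
    also have "\<dots> = (\<integral>S. f (dual i J j \<omega>) S \<partial>distr M configurations (P ?n))"
      by (subst integral_distr) auto
    finally show "(\<integral>d. ?g (?R {i..<?n} \<omega>, d) \<partial>?DB)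
        = (\<integral>S. f (dual i J j \<omega>) S \<partial>distr M configurations (P ?n))" .
  qed
  finally show ?thesis .
qed

lemma shrink_bound_lower_bound: "exp (- 4 * lmax) * (1 - exp (- lmin))\<^sup>2 \<le> shrink_bound (r i)"
  unfolding shrink_bound_def using rate_bounds(1) rate_bounds(2)[of i] rate_bounds(3)[of i]
  by (intro mult_mono power_mono) auto

lemma expected_potential_decreases:
  assumes "0 \<le> m"
  shows "expectation (\<lambda>\<omega>. potential m (length_of (dual i J (Suc j) \<omega>)))
    \<le> expectation (\<lambda>\<omega>. potential m (length_of (dual i J j \<omega>)))
      - exp (- 4 * lmax) * (1 - exp (- lmin))\<^sup>2 * prob {\<omega> \<in> space M. length_of (dual i J j \<omega>) \<in> {0<..m}}"
proof -
  let ?D = "distr M configurations (P (i + int j))"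
  let ?c = "exp (- 4 * lmax) * (1 - exp (- lmin))\<^sup>2"
  let ?E = "{\<omega> \<in> space M. length_of (dual i J j \<omega>) \<in> {0<..m}}"
  let ?f = "\<lambda>I S. potential m (length_of (basin I S))"
  interpret D: void_law ?D "r (i + int j)" by (rule law)
  have [measurable]: "(\<lambda>p. basin (fst p) (snd p))
      \<in> (borel \<Otimes>\<^sub>M borel) \<Otimes>\<^sub>M configurations \<rightarrow>\<^sub>M borel \<Otimes>\<^sub>M borel"
    by (rule basin_measurable) measurable
  note bounds = potential_bounds[OF assms]
  have int_V: "integrable M (\<lambda>\<omega>. potential m (length_of (dual i J j \<omega>)))"
    by (rule integrable_const_bound[where B = "m\<^sup>2 + 1"]) (use bounds in auto)
  have int_E: "integrable M (\<lambda>\<omega>. ?c * indicator ?E \<omega>)"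
    by (intro integrable_mult_right integrable_const_bound[where B = 1]) auto
  have "expectation (\<lambda>\<omega>. potential m (length_of (dual i J (Suc j) \<omega>)))
      = expectation (\<lambda>\<omega>. ?f (dual i J j \<omega>) (P (i + int j) \<omega>))"
    by (simp add: dual_def)
  also have "\<dots> = expectation (\<lambda>\<omega>. \<integral>S. ?f (dual i J j \<omega>) S \<partial>?D)"
    by (rule expectation_next_column[where K = "m\<^sup>2 + 1"]) (use bounds in auto)
  also have "\<dots> \<le> expectation (\<lambda>\<omega>. potential m (length_of (dual i J j \<omega>)) - ?c * indicator ?E \<omega>)"
  proof (rule integral_mono')
    show "(\<integral>S. ?f (dual i J j \<omega>) S \<partial>?D) \<le> potential m (length_of (dual i J j \<omega>)) - ?c * indicator ?E \<omega>"
      if "\<omega> \<in> space M" for \<omega>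
    proof -
      have "(\<integral>S. ?f (dual i J j \<omega>) S \<partial>?D) \<le> potential m (length_of (dual i J j \<omega>))
          - shrink_bound (r (i + int j)) * indicator {0<..m} (length_of (dual i J j \<omega>))"
        by (rule D.potential_drift[OF assms])
      also have "\<dots> \<le> potential m (length_of (dual i J j \<omega>))
          - ?c * indicator {0<..m} (length_of (dual i J j \<omega>))"
        by (intro diff_left_mono mult_right_mono shrink_bound_lower_bound) auto
      also have "indicator {0<..m} (length_of (dual i J j \<omega>)) = (indicator ?E \<omega> :: real)"
        using that by (auto split: split_indicator)
      finally show ?thesis .
    qed
    then show "0 \<le> potential m (length_of (dual i J j \<omega>)) - ?c * indicator ?E \<omega>" if "\<omega> \<in> space M" for \<omega>
      using that bounds by (meson Bochner_Integration.integral_nonneg order_trans)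
  qed (use int_V int_E in auto)
  also have "\<dots> = expectation (\<lambda>\<omega>. potential m (length_of (dual i J j \<omega>))) - ?c * prob ?E"
    using int_V int_E by simp
  finally show ?thesis .
qed

text \<open>With \<open>m = sqrt k\<close>, time spent in \<open>(0, m]\<close> and the
  probability to be beyond \<open>m\<close> are both controlled by the initial potential \<open>V
  0\<close>, and \<open>V 0\<close> is of order \<open>m * length_of J\<close>.\<close>

lemma survival_bound:
  assumes J: "0 < length_of J" and k: "0 < k"
  shows "prob {\<omega> \<in> space M. 0 < length_of (dual i J k \<omega>)}
    \<le> (1 + 1 / (exp (- 4 * lmax) * (1 - exp (- lmin))\<^sup>2)) * (2 * length_of J / sqrt k + 1 / k)"
proof -
  define c where "c = exp (- 4 * lmax) * (1 - exp (- lmin))\<^sup>2"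
  define m where "m = sqrt (real k)"
  define V where "V j = expectation (\<lambda>\<omega>. potential m (length_of (dual i J j \<omega>)))" for j
  define p where "p j = prob {\<omega> \<in> space M. 0 < length_of (dual i J j \<omega>)}" for j
  define q where "q j = prob {\<omega> \<in> space M. length_of (dual i J j \<omega>) \<in> {0<..m}}" for j
  have c: "0 < c" using rate_bounds(1) by (simp add: c_def)
  have m: "0 < m" "m\<^sup>2 = k" using k by (auto simp: m_def)
  note bounds = potential_bounds[OF less_imp_le[OF m(1)]]
  have V_Suc: "V (Suc j) \<le> V j - c * q j" for j
    unfolding V_def c_def q_def by (rule expected_potential_decreases) (use m in simp)
  have V_nonneg: "0 \<le> V j" for j
    unfolding V_def by (rule integral_nonneg_AE) (use bounds in auto)
  \<comment> \<open>The expected time spent in \<open>(0, m]\<close>, by telescoping.\<close>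
  have sum_q: "V n + c * (\<Sum>j<n. q j) \<le> V 0" for n
  proof (induction n)
    case (Suc n)
    then show ?case using V_Suc[of n] by (simp add: algebra_simps)
  qed simp
  have V_le: "V n \<le> V 0" for n
  proof -
    have "0 \<le> c * (\<Sum>j<n. q j)" using c by (intro mult_nonneg_nonneg sum_nonneg) (auto simp: q_def)
    with sum_q[of n] show ?thesis by linarith
  qed
  have p_q: "p j \<le> q j + V 0 / k" for j
  proof -
    let ?H = "{\<omega> \<in> space M. m < length_of (dual i J j \<omega>)}"
    have "p j \<le> prob ({\<omega> \<in> space M. length_of (dual i J j \<omega>) \<in> {0<..m}} \<union> ?H)"
      unfolding p_def by (intro finite_measure_mono) auto
    also have "\<dots> \<le> q j + prob ?H"
      unfolding q_def by (intro measure_Un_le) auto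
    finally have "p j \<le> q j + prob ?H" .
    \<comment> \<open>Markov's inequality: beyond \<open>m\<close> the potential is at least
      \<open>m\<^sup>2 = k\<close>.\<close>
    have "k * prob ?H \<le> V 0"
    proof -
      have "k * prob ?H = expectation (\<lambda>\<omega>. real k * indicator ?H \<omega>)" by simp
      also have "\<dots> \<le> V j"
        unfolding V_def
      proof (rule integral_mono)
        show "integrable M (\<lambda>\<omega>. real k * indicator ?H \<omega> :: real)"
          by (intro integrable_mult_right integrable_const_bound[where B = 1]) auto
        show "integrable M (\<lambda>\<omega>. potential m (length_of (dual i J j \<omega>)))"
          by (rule integrable_const_bound[where B = "m\<^sup>2 + 1"]) (use bounds in auto)
        show "real k * indicator ?H \<omega> \<le> potential m (length_of (dual i J j \<omega>))" for \<omega>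
        proof (cases "\<omega> \<in> ?H")
          case True
          then have "m < length_of (dual i J j \<omega>)" by simp
          with m True show ?thesis by (simp add: potential_def)
        qed (use bounds(1) in simp)
      qed
      also have "\<dots> \<le> V 0" by (rule V_le)
      finally show ?thesis .
    qed
    then have "prob ?H \<le> V 0 / k" using k by (simp add: field_simps)
    with \<open>p j \<le> q j + prob ?H\<close> show ?thesis by linarith
  qed
  have p_antimono: "p k \<le> p j" if "j \<le> k" for j
  proof -
    have "{\<omega> \<in> space M. 0 < length_of (dual i J k \<omega>)} \<subseteq> {\<omega> \<in> space M. 0 < length_of (dual i J j \<omega>)}"
      unfolding dual_def using dual_interval_survival_antimono[OF that] by blast
    then show ?thesis unfolding p_def by (intro finite_measure_mono) auto
  qed
  have "k * p k = (\<Sum>j<k. p k)" by simp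
  also have "\<dots> \<le> (\<Sum>j<k. q j + V 0 / k)"
    by (intro sum_mono order_trans[OF p_antimono p_q]) auto
  also have "\<dots> = (\<Sum>j<k. q j) + V 0" using k by (simp add: sum.distrib)
  also have "\<dots> \<le> V 0 / c + V 0"
    using sum_q[of k] V_nonneg[of k] c by (simp add: field_simps)
  finally have "p k \<le> (1 + 1 / c) * (V 0 / k)" using k by (simp add: field_simps)
  also have "V 0 \<le> 2 * m * length_of J + 1"
  proof -
    have "V 0 = potential m (length_of J)" by (simp add: V_def dual_def prob_space)
    also have "\<dots> \<le> 2 * m * length_of J + 1"
    proof (cases "length_of J \<le> m")
      case True
      then show ?thesis using J by (simp add: potential_def power2_eq_square algebra_simps)
    next
      case False
      then have "m * m \<le> m * length_of J" using m by (intro mult_left_mono) auto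
      then show ?thesis using J m(1) False by (simp add: potential_def power2_eq_square)
    qed
    finally show ?thesis .
  qed
  also have "(2 * m * length_of J + 1) / k = 2 * length_of J / sqrt k + 1 / k"
  proof -
    have "(2 * m * length_of J + 1) / k = 2 * length_of J * (m / k) + 1 / k"
      by (simp add: add_divide_distrib)
    also have "m / k = 1 / sqrt k" using k by (simp add: m_def real_div_sqrt real_sqrt_divide field_simps)
    finally show ?thesis by simp
  qed
  finally show ?thesis using c k by (simp add: p_def c_def divide_right_mono mult_left_mono)
qed

text \<open>Since \<open>L \<ge> 1\<close>, the summand \<open>1 / n\<close> of
  \<open>survival_bound\<close> is absorbed by \<open>L / sqrt n\<close>.\<close>

lemma tau_tail_bound:
  assumes L: "1 \<le> L" and n: "0 < n"
  shows "prob {\<omega> \<in> space M. enat n \<le> tau (\<lambda>x. P x \<omega>) L x}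
    \<le> 3 * (1 + 1 / (exp (- 4 * lmax) * (1 - exp (- lmin))\<^sup>2)) * (L / sqrt n)"
proof -
  obtain i t where x: "x = (i, t)" by fastforce
  let ?J = "(t - L / 2, t + L / 2)" and ?K = "1 + 1 / (exp (- 4 * lmax) * (1 - exp (- lmin))\<^sup>2)"
  have "prob {\<omega> \<in> space M. enat n \<le> tau (\<lambda>x. P x \<omega>) L x}
      \<le> prob {\<omega> \<in> space M. 0 < length_of (dual i ?J n \<omega>)}"
  proof (rule finite_measure_mono_AE)
    show "AE \<omega> in M. \<omega> \<in> {\<omega> \<in> space M. enat n \<le> tau (\<lambda>x. P x \<omega>) L x} \<longrightarrow>
        \<omega> \<in> {\<omega> \<in> space M. 0 < length_of (dual i ?J n \<omega>)}"
      using AE_regular_columns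
    proof eventually_elim
      case (elim \<omega>)
      show ?case
      proof
        assume \<omega>: "\<omega> \<in> {\<omega> \<in> space M. enat n \<le> tau (\<lambda>x. P x \<omega>) L x}"
        then obtain k y z where k: "n \<le> Suc k" and z: "z \<in> nodes (\<lambda>x. P x \<omega>) \<inter> slit L (i, t)"
          and path: "(y, z) \<in> edges (\<lambda>x. P x \<omega>) ^^ k"
          using tau_ge_enat_iff[of n "\<lambda>x. P x \<omega>" L x] n unfolding x by auto
        have "0 < length_of (dual_interval (\<lambda>x. P x \<omega>) i ?J (Suc k))"
          using elim L by (intro long_path_survival[OF _ _ z _ path]) auto
        with dual_interval_survival_antimono[OF k] \<omega>
        show "\<omega> \<in> {\<omega> \<in> space M. 0 < length_of (dual i ?J n \<omega>)}"
          by (simp add: dual_def)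
      qed
    qed
  qed measurable
  also have "\<dots> \<le> ?K * (2 * length_of ?J / sqrt n + 1 / n)"
    using L n by (intro survival_bound) (auto simp: length_of_def)
  also have "\<dots> \<le> ?K * (3 * (L / sqrt n))"
  proof (rule mult_left_mono)
    have "sqrt n * 1 \<le> sqrt n * sqrt n" using n by (intro mult_left_mono) auto
    then have "1 / real n \<le> 1 / sqrt n" using n by (intro divide_left_mono) auto
    also have "\<dots> \<le> L / sqrt n" using L by (intro divide_right_mono) auto
    finally show "2 * length_of ?J / sqrt n + 1 / n \<le> 3 * (L / sqrt n)"
      by (simp add: length_of_def)
  qed simp
  finally show ?thesis by (simp add: mult_ac)
qed

end

section \<open>The node process\<close>

text \<open>Realisations are locally finite, so a bounded set has count \<open>0\<close> only if
  it contains no point.\<close>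

lemma void_law_poisson_process:
  assumes "prob_space M" and X: "poisson_process M X (\<lambda>_. r)" and "0 < r"
  shows "void_law (distr M configurations X) r"
proof -
  interpret prob_space M by fact
  have X_meas [measurable]: "X \<in> measurable M configurations" using X by (simp add: poisson_process_def)
  show ?thesis
  proof (intro void_law.intro void_law_axioms.intro prob_space_distr X_meas)
    fix B :: "real set" assume B: "B \<in> sets borel" "bounded B"
    have lf: "locally_finite (X \<omega>)" if "\<omega> \<in> space M" for \<omega>
      using measurable_space[OF X_meas that] by (simp add: space_configurations)
    have eq: "card (S \<inter> B) = 0 \<longleftrightarrow> S \<inter> B = {}" if "locally_finite S" for S
      using that B(2) by (simp add: locally_finite_def)
    have "{S \<in> space configurations. S \<inter> B = {}} = {S \<in> space configurations. card (S \<inter> B) = 0}"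
      using eq by (auto simp: space_configurations)
    then have sets: "{S \<in> space configurations. S \<inter> B = {}} \<in> sets configurations"
      using count_sets[OF B, of 0] by simp
    have "measure (distr M configurations X) {S \<in> space (distr M configurations X). S \<inter> B = {}}
        = measure M (X -` {S \<in> space configurations. S \<inter> B = {}} \<inter> space M)"
      using sets by (simp add: measure_distr)
    also have "X -` {S \<in> space configurations. S \<inter> B = {}} \<inter> space M = {\<omega> \<in> space M. card (X \<omega> \<inter> B) = 0}"
      using eq lf by (auto simp: space_configurations)
    also have "measure M \<dots> = exp (- (LINT t:B|lborel. r))"
      using X B by (simp add: poisson_process_def)
    also have "(LINT t:B|lborel. r) = r * measure lborel B"
      using B emeasure_bounded_finite[OF B(2)] by (simp add: set_lebesgue_integral_def)
    finally show "measure (distr M configurations X) {S \<in> space (distr M configurations X). S \<inter> B = {}}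
        = exp (- r * measure lborel B)" by simp
  qed (use \<open>0 < r\<close> in auto)
qed

theorem theorem2p5:
  fixes lam mu :: "real \<times> real \<Rightarrow> real" and Xi lmin lmax :: real
  assumes "Xi > 0"
    and "0 < lmin" and "\<forall>x. lmin \<le> lam x \<and> lam x \<le> lmax"
    and "continuous_on UNIV lam"
    and "\<forall>x1. Xi-lipschitz_on UNIV (\<lambda>x2. lam (x1, x2))"
    and "\<forall>x. 0 \<le> mu x" and "bounded (range mu)"
    and "continuous_on UNIV mu"
    and "\<forall>x1. Xi-lipschitz_on UNIV (\<lambda>x2. mu (x1, x2))"
    and homogeneous_lam: "\<forall>x1 x2 y2. lam (x1, x2) = lam (x1, y2)"
    and homogeneous_mu: "\<forall>x1 x2 y2. mu (x1, x2) = mu (x1, y2)"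
  shows "\<exists>C::real. \<forall>\<alpha>>2. \<forall>l\<ge>1. \<forall>(M :: 'w measure) P.
    node_process M lam (l powr (1 / \<alpha>)) P \<longrightarrow>
    (SUP x::int \<times> real. measure M {\<omega> \<in> space M.
        ereal_of_enat (tau (\<lambda>x1. P x1 \<omega>) (l powr (1 / \<alpha>)) x) \<ge> ereal l})
      < C * l powr (1 / \<alpha> - 1 / 2)"
proof -
  define K where "K = 3 * (1 + 1 / (exp (- 4 * lmax) * (1 - exp (- lmin))\<^sup>2))"
  have "0 \<le> K" by (simp add: K_def)
  have "(SUP x::int \<times> real. measure M {\<omega> \<in> space M.
        ereal_of_enat (tau (\<lambda>x1. P x1 \<omega>) (l powr (1 / \<alpha>)) x) \<ge> ereal l})
      < (K + 1) * l powr (1 / \<alpha> - 1 / 2)"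
    if \<alpha>: "2 < \<alpha>" and l: "1 \<le> l" and process: "node_process M lam (l powr (1 / \<alpha>)) P"
    for \<alpha> l :: real and M :: "'w measure" and P
  proof -
    define L where "L = l powr (1 / \<alpha>)"
    define r where "r i = lam (real_of_int i / L\<^sup>2, 0)" for i
    have "rescale lam L (real_of_int i, t) = r i" for i t
      using homogeneous_lam unfolding rescale_def r_def by simp
    then have poisson: "poisson_process M (P i) (\<lambda>_. r i)" for i
      using process by (simp add: node_process_def L_def)
    have r: "lmin \<le> r i" "r i \<le> lmax" for i using assms(3) by (auto simp: r_def)
    have M: "prob_space M" "prob_space.indep_vars M (\<lambda>_. configurations) P UNIV"
      using process by (auto simp: node_process_def)
    have law: "void_law (distr M configurations (P i)) (r i)" for i
      using \<open>0 < lmin\<close> r(1)[of i] by (intro void_law_poisson_process M(1) poisson) linarith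
    interpret columns M P r lmin lmax
      by (intro columns.intro columns_axioms.intro M law r \<open>0 < lmin\<close>)
    define n where "n = nat \<lceil>l\<rceil>"
    have n: "0 < n" "l \<le> real n" using l by (auto simp: n_def)
    have L: "1 \<le> L" using l \<alpha> by (simp add: L_def ge_one_powr_ge_zero)
    have ev: "ereal l \<le> ereal_of_enat t \<longleftrightarrow> enat n \<le> t" for t
      using l by (cases t) (auto simp: n_def nat_le_iff ceiling_le_iff)
    have "(SUP x. prob {\<omega> \<in> space M. ereal l \<le> ereal_of_enat (tau (\<lambda>x1. P x1 \<omega>) L x)}) \<le> K * (L / sqrt n)"
      unfolding ev K_def by (intro cSUP_least tau_tail_bound L n) auto
    also have "\<dots> \<le> K * (L / sqrt l)"
      using \<open>0 \<le> K\<close> L l n by (intro mult_left_mono divide_left_mono) auto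
    also have "L / sqrt l = l powr (1 / \<alpha> - 1 / 2)"
      using l by (simp add: L_def powr_diff powr_half_sqrt)
    also have "K * l powr (1 / \<alpha> - 1 / 2) < (K + 1) * l powr (1 / \<alpha> - 1 / 2)"
      using l by simp
    finally show ?thesis by (simp add: L_def)
  qed
  then show ?thesis by blast
qed

end
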